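(* Let $W$ be the Weyl group of a complex semisimple Lie algebra with positive roots $\Delta^+\subset\mathfrak{t}^*$. For all $a,w\in W$, $$\tau_a=\sum_{b\le_L a}\tau_{ab^{-1}}(w^{-1})\,\tau_b^w,\qquad \tau_a^w=\sum_{b\le_L a}(-1)^{\ell(ba^{-1})}\tau_{ba^{-1}}(w^{-1})\,\tau_b,$$ where $\le_L$ is the left weak order: $v\le_L u$ iff $\ell(uv^{-1})=\ell(u)-\ell(v)$.
   Context: $\ell$ is the length function on $W$. $H_\alpha^*(W)$ is the ring of maps $f\colon W\to\mathbb{S}(\mathfrak{t}^* )$ with $f(ws_\beta)-f(w)\in(w\beta)\mathbb{S}(\mathfrak{t}^* )$ for all $w\in W$, $\beta\in\Delta^+$. For $f\in H_\alpha^*(W)$ and $w\in W$, the permuted class is $f^w(v)=w^{-1}\cdot f(wv)$. For each $u\in W$ the equivariant Schubert class $\tau_u$ is the unique class in $H_\alpha^*(W)$ that is homogeneous of polynomial degree $\ell(u)$, is supported on $\{v: u\preccurlyeq v\}$ ($\preccurlyeq$ the strong Bruhat order), and satisfies $\tau_u(u)=\prod\{\beta\in\Delta^+: u^{-1}\beta\in-\Delta^+\}$. *)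

theory Defs
  imports Complex_Main "HOL-Library.Function_Algebras" "HOL-Library.FuncSet"
begin

text \<open>
  The data \<open>(\<tt>, \<Delta>, \<Delta>\<^sup>+)\<close> attached to a complex semisimple Lie algebra with Cartan subalgebra
  \<open>\<tt>\<close>: a reduced crystallographic root system \<open>R\<close> in the complex dual space of \<open>\<tt>\<close>, together with
  a base of simple roots. The type \<open>'t\<close> is \<open>\<tt>\<close>, so roots are linear functionals on \<open>'t\<close>. Since \<open>R\<close> is
  finite and spanning, the coroots of roots are determined by \<open>R\<close>. Ring operations on functions
  are pointwise.
\<close>

locale semisimple_root_system = vector_space scale
  for scale :: "complex \<Rightarrow> 't::ab_group_add \<Rightarrow> 't" (infixr "*s" 75) +
  fixes R :: "('t \<Rightarrow> complex) set"
    and coroot :: "('t \<Rightarrow> complex) \<Rightarrow> 't"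
    and base :: "('t \<Rightarrow> complex) set"
  assumes finite_dim: "\<exists>B. finite B \<and> span B = UNIV"
    and finite_roots: "finite R"
    and root_linear: "\<beta> \<in> R \<Longrightarrow> Vector_Spaces.linear scale (*) \<beta>"
    and root_nonzero: "0 \<notin> R"
    and roots_span: "Vector_Spaces.linear scale (*) \<mu> \<Longrightarrow> \<exists>c. \<mu> = (\<lambda>x. \<Sum>\<beta>\<in>R. c \<beta> * \<beta> x)"
    and coroot_two: "\<beta> \<in> R \<Longrightarrow> \<beta> (coroot \<beta>) = 2"
    and reflection_root: "\<alpha> \<in> R \<Longrightarrow> \<beta> \<in> R \<Longrightarrow> (\<lambda>x. \<beta> x - \<beta> (coroot \<alpha>) * \<alpha> x) \<in> R"
    and crystallographic: "\<alpha> \<in> R \<Longrightarrow> \<beta> \<in> R \<Longrightarrow> \<beta> (coroot \<alpha>) \<in> \<int>"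
    and reduced: "\<beta> \<in> R \<Longrightarrow> (\<lambda>x. k * \<beta> x) \<in> R \<Longrightarrow> k = 1 \<or> k = -1"
    and base_subset: "base \<subseteq> R"
    and base_independent: "(\<And>x. (\<Sum>\<alpha>\<in>base. c \<alpha> * \<alpha> x) = 0) \<Longrightarrow> \<alpha> \<in> base \<Longrightarrow> c \<alpha> = 0"
    and base_sign: "\<beta> \<in> R \<Longrightarrow> \<exists>m :: ('t \<Rightarrow> complex) \<Rightarrow> nat.
          \<beta> = (\<lambda>x. \<Sum>\<alpha>\<in>base. of_nat (m \<alpha>) * \<alpha> x) \<or> \<beta> = (\<lambda>x. - (\<Sum>\<alpha>\<in>base. of_nat (m \<alpha>) * \<alpha> x))"
begin

definition pos_roots :: "('t \<Rightarrow> complex) set"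
  where "pos_roots =
    {\<beta> \<in> R. \<exists>m :: ('t \<Rightarrow> complex) \<Rightarrow> nat. \<beta> = (\<lambda>x. \<Sum>\<alpha>\<in>base. of_nat (m \<alpha>) * \<alpha> x)}"

definition srefl :: "('t \<Rightarrow> complex) \<Rightarrow> 't \<Rightarrow> 't"
  where "srefl \<beta> x = x - \<beta> x *s coroot \<beta>"

text \<open>
  The Weyl group is realised by its faithful action on \<open>\<tt>\<close>: the product is \<open>\<circ>\<close>, the inverse
  is \<open>inv\<close>.
\<close>

inductive_set weyl :: "('t \<Rightarrow> 't) set"
  where
    one: "id \<in> weyl"
  | step: "\<beta> \<in> R \<Longrightarrow> w \<in> weyl \<Longrightarrow> srefl \<beta> \<circ> w \<in> weyl"

definition len :: "('t \<Rightarrow> 't) \<Rightarrow> nat"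
  where "len w = (LEAST n. \<exists>as. length as = n \<and> set as \<subseteq> base \<and>
                    w = foldr (\<lambda>\<alpha> v. srefl \<alpha> \<circ> v) as id)"

text \<open>
  The symmetric algebra of the dual of \<open>\<tt>\<close>, as the algebra of polynomial functions on \<open>\<tt>\<close>, and
  its homogeneous components.
\<close>

inductive_set Sym :: "('t \<Rightarrow> complex) set"
  where
    const: "(\<lambda>_. c) \<in> Sym"
  | linear: "Vector_Spaces.linear scale (*) \<mu> \<Longrightarrow> \<mu> \<in> Sym"
  | add: "p \<in> Sym \<Longrightarrow> q \<in> Sym \<Longrightarrow> p + q \<in> Sym"
  | mult: "p \<in> Sym \<Longrightarrow> q \<in> Sym \<Longrightarrow> p * q \<in> Sym"

inductive_set Sym_deg_graph :: "(nat \<times> ('t \<Rightarrow> complex)) set"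
  where
    const: "(0, \<lambda>_. c) \<in> Sym_deg_graph"
  | mult: "Vector_Spaces.linear scale (*) \<mu> \<Longrightarrow> (d, p) \<in> Sym_deg_graph \<Longrightarrow>
             (Suc d, \<mu> * p) \<in> Sym_deg_graph"
  | add: "(d, p) \<in> Sym_deg_graph \<Longrightarrow> (d, q) \<in> Sym_deg_graph \<Longrightarrow> (d, p + q) \<in> Sym_deg_graph"

definition Sym_deg :: "nat \<Rightarrow> ('t \<Rightarrow> complex) set"
  where "Sym_deg d = {p. (d, p) \<in> Sym_deg_graph}"

text \<open>The contragredient action on the dual of \<open>\<tt>\<close>, extended to its symmetric algebra.\<close>

definition act :: "('t \<Rightarrow> 't) \<Rightarrow> ('t \<Rightarrow> complex) \<Rightarrow> 't \<Rightarrow> complex"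
  where "act w p = p \<circ> inv w"

definition H :: "(('t \<Rightarrow> 't) \<Rightarrow> 't \<Rightarrow> complex) set"
  where "H = {f \<in> weyl \<rightarrow>\<^sub>E Sym. \<forall>w\<in>weyl. \<forall>\<beta>\<in>pos_roots.
                \<exists>q\<in>Sym. f (w \<circ> srefl \<beta>) - f w = act w \<beta> * q}"

definition permuted :: "(('t \<Rightarrow> 't) \<Rightarrow> 't \<Rightarrow> complex) \<Rightarrow> ('t \<Rightarrow> 't) \<Rightarrow> ('t \<Rightarrow> 't) \<Rightarrow> 't \<Rightarrow> complex"
  where "permuted f w = (\<lambda>v\<in>weyl. act (inv w) (f (w \<circ> v)))"

definition bruhat :: "('t \<Rightarrow> 't) \<Rightarrow> ('t \<Rightarrow> 't) \<Rightarrow> bool"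
  where "bruhat = (\<lambda>u v. u \<in> weyl \<and> (\<exists>\<beta>\<in>pos_roots. v = u \<circ> srefl \<beta> \<and> len u < len v))\<^sup>*\<^sup>*"

definition left_weak :: "('t \<Rightarrow> 't) \<Rightarrow> ('t \<Rightarrow> 't) \<Rightarrow> bool"
  where "left_weak v u \<longleftrightarrow> int (len (u \<circ> inv v)) = int (len u) - int (len v)"

definition is_schubert :: "('t \<Rightarrow> 't) \<Rightarrow> (('t \<Rightarrow> 't) \<Rightarrow> 't \<Rightarrow> complex) \<Rightarrow> bool"
  where "is_schubert u f \<longleftrightarrow>
    f \<in> H \<and>
    (\<forall>v\<in>weyl. f v \<in> Sym_deg (len u)) \<and>
    (\<forall>v\<in>weyl. f v \<noteq> 0 \<longrightarrow> bruhat u v) \<and>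
    f u = (\<Prod>\<beta> \<in> {\<beta> \<in> pos_roots. act (inv u) \<beta> \<in> uminus ` pos_roots}. \<beta>)"

definition schubert :: "('t \<Rightarrow> 't) \<Rightarrow> ('t \<Rightarrow> 't) \<Rightarrow> 't \<Rightarrow> complex"
  where "schubert u = (THE f. is_schubert u f)"

end

end

theory Submission
  imports Defs "HOL-Computational_Algebra.Polynomial"
begin

text \<open>
  For a simple root \<open>\<alpha>\<close> with reflection \<open>s\<close>, the left divided difference
  \<open>(f(v) - s\<cdot>f(s v)) / \<alpha>\<close> preserves the defining congruences and lowers the degree by one. A class
  whose values have degree \<open>d\<close> and whose support has lengths \<open>> d\<close> vanishes, because a value at a
  support element \<open>v\<close> of minimal length is killed on \<open>\<ell>(v)\<close> distinct hyperplanes. This gives uniqueness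
  of Schubert classes, and shows that the divided difference sends \<open>\<tau>\<^sub>a\<close> to \<open>\<tau>\<^bsub>s a\<^esub>\<close> if \<open>s a < a\<close> and
  to \<open>0\<close> otherwise; existence follows by descending from the longest element. Hence
  \<open>\<tau>\<^sub>a = \<tau>\<^sub>a\<^sup>s + [s a < a] \<alpha> \<tau>\<^bsub>s a\<^esub>\<close>, and both expansions follow by induction on \<open>w\<close>, passing from
  \<open>w\<close> to \<open>w s\<close>.
\<close>

text \<open>Both expansions concern left translation by \<open>w\<close>, so everything is arranged
  on the left. The congruences and the Bruhat steps are given with right factors
  \<open>w \<circ> srefl \<beta>\<close>; conjugation turns these into left factors
  \<open>srefl \<gamma> \<circ> w\<close> with \<gamma> the root \<open>act w \<beta>\<close>.
  Divisibility by \<gamma> becomes equality of values on the hyperplane of \<gamma>, and the algebra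
  of polynomial functions reduces to counting zeros on complex lines, without factorization theory.
  The coroots are given only by axioms, so even conjugating reflections first needs that a root
  determines its coroot. In the induction, permuting by \<open>w s\<close> is permuting by
  \<open>w\<close> followed by one left reflection, and the inverse of \<open>w s\<close> is
  \<open>s\<close> times the inverse of \<open>w\<close>. One reflection identity thus governs both
  classes and coefficients, and only correction terms must be matched. In the first formula those of
  the coefficients add up to \<alpha> times the expansion for \<open>s a\<close>. In the second,
  those of the classes and those of the coefficients correspond under \<open>b\<close> to
  \<open>s b\<close>, and the alternating sign makes them agree.\<close>

context semisimple_root_system
begin

subsection \<open>Linear functionals and the reflection action\<close>

abbreviation functional :: "('t \<Rightarrow> complex) \<Rightarrow> bool"
  where "functional \<equiv> Vector_Spaces.linear scale (*)"

abbreviation endo :: "('t \<Rightarrow> 't) \<Rightarrow> bool"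
  where "endo \<equiv> Vector_Spaces.linear scale scale"

lemma vector_space_complex: "vector_space ((*) :: complex \<Rightarrow> complex \<Rightarrow> complex)"
  by unfold_locales (auto simp: algebra_simps)

lemma functional_iff:
  "functional \<mu> \<longleftrightarrow> (\<forall>x y. \<mu> (x + y) = \<mu> x + \<mu> y) \<and> (\<forall>c x. \<mu> (c *s x) = c * \<mu> x)"
  using vector_space_complex vector_space_axioms by (simp add: Vector_Spaces.linear_iff)

lemma endo_iff:
  "endo u \<longleftrightarrow> (\<forall>x y. u (x + y) = u x + u y) \<and> (\<forall>c x. u (c *s x) = c *s u x)"
  using vector_space_axioms by (simp add: Vector_Spaces.linear_iff)

lemma functional_zero: "functional \<mu> \<Longrightarrow> \<mu> 0 = 0"
  by (metis add_cancel_right_left functional_iff add.right_neutral)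

lemma functional_minus: "functional \<mu> \<Longrightarrow> \<mu> (- x) = - \<mu> x"
  by (metis functional_iff functional_zero add_eq_0_iff add.right_inverse)

lemma functional_diff: "functional \<mu> \<Longrightarrow> \<mu> (x - y) = \<mu> x - \<mu> y"
  by (metis functional_iff functional_minus diff_conv_add_uminus)

lemma functional_add: "functional \<mu> \<Longrightarrow> \<mu> (x + y) = \<mu> x + \<mu> y"
  and functional_scale: "functional \<mu> \<Longrightarrow> \<mu> (c *s x) = c * \<mu> x"
  by (simp_all add: functional_iff)

lemma endo_diff: "endo u \<Longrightarrow> u (x - y) = u x - u y"
  by (metis endo_iff add_diff_cancel_right' diff_add_cancel)

lemma functional_comp: "functional \<mu> \<Longrightarrow> endo u \<Longrightarrow> functional (\<mu> \<circ> u)"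
  by (simp add: functional_iff endo_iff)

text \<open>A functional with value 1 at a nonzero \<open>h\<close> would be a combination of roots,
  all of which vanish there. This is where semisimplicity, in the form of spanning roots,
  enters.\<close>

lemma roots_separate:
  assumes "\<And>\<beta>. \<beta> \<in> R \<Longrightarrow> \<beta> h = 0"
  shows "h = 0"
proof (rule ccontr)
  assume "h \<noteq> 0"
  interpret vsp: vector_space_pair scale "(*) :: complex \<Rightarrow> complex \<Rightarrow> complex"
    by (intro vector_space_pair.intro vector_space_axioms vector_space_complex)
  have "independent {h}"
    using \<open>h \<noteq> 0\<close> by simp
  then obtain \<mu> where "functional \<mu>" "\<mu> h = 1"
    using vsp.linear_independent_extend[of "{h}" "\<lambda>_. 1"] by auto
  moreover obtain c where "\<mu> = (\<lambda>x. \<Sum>\<beta>\<in>R. c \<beta> * \<beta> x)"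
    using roots_span[OF \<open>functional \<mu>\<close>] by auto
  moreover have "(\<Sum>\<beta>\<in>R. c \<beta> * \<beta> h) = 0" for c
    using assms by (intro sum.neutral) simp
  ultimately show False
    by simp
qed

lemma srefl_endo: "\<beta> \<in> R \<Longrightarrow> endo (srefl \<beta>)"
  using root_linear[of \<beta>]
  by (auto simp: endo_iff functional_iff srefl_def algebra_simps scale_left_distrib scale_right_diff_distrib)

lemma srefl_srefl: "\<beta> \<in> R \<Longrightarrow> srefl \<beta> (srefl \<beta> x) = x"
  using root_linear[of \<beta>] coroot_two[of \<beta>]
  by (simp add: srefl_def functional_diff functional_scale algebra_simps)

lemma srefl_involution: "\<beta> \<in> R \<Longrightarrow> srefl \<beta> \<circ> srefl \<beta> = id"
  by (rule ext) (simp add: srefl_srefl)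

lemma srefl_bij: "\<beta> \<in> R \<Longrightarrow> bij (srefl \<beta>)"
  using srefl_involution o_bij by blast

lemma inv_srefl: "\<beta> \<in> R \<Longrightarrow> inv (srefl \<beta>) = srefl \<beta>"
  using srefl_involution inv_unique_comp by blast

lemma root_comp_srefl: "\<alpha> \<in> R \<Longrightarrow> \<beta> \<in> R \<Longrightarrow> \<beta> \<circ> srefl \<alpha> \<in> R"
proof -
  assume "\<alpha> \<in> R" "\<beta> \<in> R"
  moreover from this have "\<beta> \<circ> srefl \<alpha> = (\<lambda>x. \<beta> x - \<beta> (coroot \<alpha>) * \<alpha> x)"
    using root_linear[of \<beta>] by (auto simp: srefl_def functional_diff functional_scale)
  ultimately show ?thesis
    using reflection_root by simp
qed

lemma root_comp_self: "\<beta> \<in> R \<Longrightarrow> \<beta> \<circ> srefl \<beta> = - \<beta>"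
  using root_linear[of \<beta>] coroot_two[of \<beta>]
  by (auto simp: srefl_def functional_diff functional_scale)

lemma root_minus: "\<beta> \<in> R \<Longrightarrow> - \<beta> \<in> R"
  using root_comp_srefl[of \<beta> \<beta>] by (simp add: root_comp_self)

text \<open>Two reflections with the same root differ by a transvection, whose powers would move some root
  through infinitely many roots.\<close>

lemma coroot_unique:
  assumes \<gamma>: "\<gamma> \<in> R" and h: "\<gamma> h = 2"
    and pres: "\<And>\<beta>. \<beta> \<in> R \<Longrightarrow> (\<lambda>x. \<beta> x - \<beta> h * \<gamma> x) \<in> R"
  shows "coroot \<gamma> = h"
proof -
  define d where "d = h - coroot \<gamma>"
  have "\<beta> d = 0" if \<beta>: "\<beta> \<in> R" for \<beta>
  proof (rule ccontr)
    assume nz: "\<beta> d \<noteq> 0"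
    have step: "(\<lambda>x. \<delta> x + \<delta> d * \<gamma> x) \<in> R" if "\<delta> \<in> R" for \<delta>
    proof -
      have "(\<lambda>x. \<delta> x - \<delta> h * \<gamma> x) \<circ> srefl \<gamma> \<in> R"
        using root_comp_srefl[OF \<gamma> pres[OF that]] .
      moreover have "(\<lambda>x. \<delta> x - \<delta> h * \<gamma> x) \<circ> srefl \<gamma> = (\<lambda>x. \<delta> x + \<delta> d * \<gamma> x)"
        using root_linear[OF that] root_linear[OF \<gamma>] coroot_two[OF \<gamma>]
        by (auto simp: srefl_def d_def functional_diff functional_scale algebra_simps)
      ultimately show ?thesis by simp
    qed
    have \<gamma>d: "\<gamma> d = 0"
      using h coroot_two[OF \<gamma>] functional_diff[OF root_linear[OF \<gamma>]] by (simp add: d_def)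
    have all: "(\<lambda>x. \<beta> x + of_nat n * \<beta> d * \<gamma> x) \<in> R" for n
    proof (induction n)
      case (Suc n)
      have "(\<lambda>x. \<beta> x + of_nat (Suc n) * \<beta> d * \<gamma> x)
          = (\<lambda>x. (\<beta> x + of_nat n * \<beta> d * \<gamma> x) + (\<beta> d + of_nat n * \<beta> d * \<gamma> d) * \<gamma> x)"
        using \<gamma>d by (simp add: algebra_simps)
      with step[OF Suc] show ?case
        by (simp only:)
    qed (use \<beta> in simp)
    have "inj (\<lambda>n x. \<beta> x + of_nat n * \<beta> d * \<gamma> x)"
    proof (rule injI)
      fix m n
      assume "(\<lambda>x. \<beta> x + of_nat m * \<beta> d * \<gamma> x) = (\<lambda>x. \<beta> x + of_nat n * \<beta> d * \<gamma> x)"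
      from fun_cong[OF this, of h] show "m = n"
        using nz h by simp
    qed
    then have "infinite (range (\<lambda>n x. \<beta> x + of_nat n * \<beta> d * \<gamma> x))"
      using finite_imageD by blast
    moreover have "range (\<lambda>n x. \<beta> x + of_nat n * \<beta> d * \<gamma> x) \<subseteq> R"
      using all by (intro image_subsetI)
    ultimately show False
      using finite_subset finite_roots by blast
  qed
  then have "d = 0" by (rule roots_separate)
  then show ?thesis by (simp add: d_def)
qed

text \<open>The conjugate of the reflection in \<beta> by that in \<alpha> permutes the roots and
  has the form required by \<open>coroot_unique\<close>, with root
  \<open>\<beta> \<circ> srefl \<alpha>\<close> and vector
  \<open>srefl \<alpha> (coroot \<beta>)\<close>.\<close>

lemma coroot_comp_srefl:
  assumes \<alpha>: "\<alpha> \<in> R" and \<beta>: "\<beta> \<in> R"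
  shows "coroot (\<beta> \<circ> srefl \<alpha>) = srefl \<alpha> (coroot \<beta>)"
proof (rule coroot_unique)
  show "\<beta> \<circ> srefl \<alpha> \<in> R" using assms by (rule root_comp_srefl)
  show "(\<beta> \<circ> srefl \<alpha>) (srefl \<alpha> (coroot \<beta>)) = 2"
    using assms by (simp add: srefl_srefl coroot_two)
  fix \<delta> assume \<delta>: "\<delta> \<in> R"
  have "(\<lambda>x. \<delta> x - \<delta> (srefl \<alpha> (coroot \<beta>)) * (\<beta> \<circ> srefl \<alpha>) x) = ((\<delta> \<circ> srefl \<alpha>) \<circ> srefl \<beta>) \<circ> srefl \<alpha>"
  proof
    fix x
    have "functional (\<delta> \<circ> srefl \<alpha>)"
      using root_linear root_comp_srefl \<alpha> \<delta> by blast
    then show "\<delta> x - \<delta> (srefl \<alpha> (coroot \<beta>)) * (\<beta> \<circ> srefl \<alpha>) x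
        = (((\<delta> \<circ> srefl \<alpha>) \<circ> srefl \<beta>) \<circ> srefl \<alpha>) x"
      using functional_diff[of "\<delta> \<circ> srefl \<alpha>" "srefl \<alpha> x"] functional_scale[of "\<delta> \<circ> srefl \<alpha>"]
        srefl_srefl[OF \<alpha>] by (simp add: srefl_def[of \<beta>])
  qed
  then show "(\<lambda>x. \<delta> x - \<delta> (srefl \<alpha> (coroot \<beta>)) * (\<beta> \<circ> srefl \<alpha>) x) \<in> R"
    by (simp only:) (intro root_comp_srefl \<alpha> \<beta> \<delta>)
qed

lemma srefl_comp_srefl:
  assumes "\<alpha> \<in> R" "\<beta> \<in> R"
  shows "srefl (\<beta> \<circ> srefl \<alpha>) = srefl \<alpha> \<circ> srefl \<beta> \<circ> srefl \<alpha>"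
proof
  fix x
  have "endo (srefl \<alpha>)" using assms srefl_endo by blast
  then have "srefl \<alpha> (srefl \<alpha> x - \<beta> (srefl \<alpha> x) *s coroot \<beta>) = srefl \<alpha> (srefl \<alpha> x) - \<beta> (srefl \<alpha> x) *s srefl \<alpha> (coroot \<beta>)"
    by (metis endo_iff endo_diff)
  then show "srefl (\<beta> \<circ> srefl \<alpha>) x = (srefl \<alpha> \<circ> srefl \<beta> \<circ> srefl \<alpha>) x"
    using assms by (simp add: srefl_def[of "\<beta> \<circ> srefl \<alpha>"] coroot_comp_srefl srefl_srefl srefl_def[of \<beta>])
qed

lemma srefl_minus: "\<beta> \<in> R \<Longrightarrow> srefl (- \<beta>) = srefl \<beta>"
  using srefl_comp_srefl[of \<beta> \<beta>] by (simp add: root_comp_self srefl_involution o_assoc[symmetric])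

section \<open>The Weyl group and its action on roots\<close>

lemma weyl_bij: "w \<in> weyl \<Longrightarrow> bij w"
  by (induction rule: weyl.induct) (blast intro: bij_id bij_comp srefl_bij)+

lemma weyl_comp: "v \<in> weyl \<Longrightarrow> w \<in> weyl \<Longrightarrow> v \<circ> w \<in> weyl"
  by (induction rule: weyl.induct) (auto simp: o_assoc[symmetric] intro: weyl.step)

lemma srefl_weyl: "\<beta> \<in> R \<Longrightarrow> srefl \<beta> \<in> weyl"
  using weyl.step[OF _ weyl.one] by simp

lemma weyl_inv: "w \<in> weyl \<Longrightarrow> inv w \<in> weyl"
proof (induction rule: weyl.induct)
  case (step \<beta> w)
  then have "inv (srefl \<beta> \<circ> w) = inv w \<circ> srefl \<beta>"
    by (simp add: o_inv_distrib srefl_bij weyl_bij inv_srefl)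
  then show ?case
    using step weyl_comp srefl_weyl by metis
next
  case one
  show "inv id \<in> weyl" by (simp add: weyl.one)
qed

lemma root_comp_weyl: "w \<in> weyl \<Longrightarrow> \<beta> \<in> R \<Longrightarrow> \<beta> \<circ> w \<in> R"
proof (induction arbitrary: \<beta> rule: weyl.induct)
  case (step \<alpha> w)
  then show ?case
    using step.IH[OF root_comp_srefl] by (simp add: o_assoc)
qed simp

lemma weyl_inv_comp: "w \<in> weyl \<Longrightarrow> inv w \<circ> w = id" "w \<in> weyl \<Longrightarrow> w \<circ> inv w = id"
  using weyl_bij bij_is_inj bij_is_surj surj_iff inv_o_cancel by metis+

lemma weyl_inv_apply [simp]: "w \<in> weyl \<Longrightarrow> inv w (w x) = x" "w \<in> weyl \<Longrightarrow> w (inv w x) = x"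
  using weyl_inv_comp by (metis comp_apply id_apply)+

lemma weyl_inv_inv: "w \<in> weyl \<Longrightarrow> inv (inv w) = w"
  using weyl_bij inv_inv_eq by blast

text \<open>Exchanges a right reflection factor for a left one. It carries both the congruences
  defining \<open>H\<close> and the Bruhat order over to left multiplication.\<close>

lemma srefl_conj: "w \<in> weyl \<Longrightarrow> \<beta> \<in> R \<Longrightarrow> w \<circ> srefl (\<beta> \<circ> w) = srefl \<beta> \<circ> w"
proof (induction arbitrary: \<beta> rule: weyl.induct)
  case (step \<alpha> w)
  have "srefl \<alpha> \<circ> w \<circ> srefl (\<beta> \<circ> (srefl \<alpha> \<circ> w)) = srefl \<alpha> \<circ> (w \<circ> srefl ((\<beta> \<circ> srefl \<alpha>) \<circ> w))"
    by (simp add: o_assoc)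
  also have "\<dots> = (srefl \<alpha> \<circ> srefl \<alpha>) \<circ> srefl \<beta> \<circ> (srefl \<alpha> \<circ> w)"
    by (simp only: step.IH[OF root_comp_srefl[OF step.hyps(1) step.prems]]
        srefl_comp_srefl[OF step.hyps(1) step.prems] o_assoc)
  finally show "srefl \<alpha> \<circ> w \<circ> srefl (\<beta> \<circ> (srefl \<alpha> \<circ> w)) = srefl \<beta> \<circ> (srefl \<alpha> \<circ> w)"
    by (simp add: srefl_involution[OF step.hyps(1)])
qed simp

subsection \<open>Positive roots, words and length\<close>

lemma finite_base: "finite base"
  using base_subset finite_roots finite_subset by blast

lemma base_combination_inject:
  assumes "(\<lambda>x. \<Sum>\<alpha>\<in>base. c \<alpha> * \<alpha> x) = (\<lambda>x. \<Sum>\<alpha>\<in>base. d \<alpha> * \<alpha> x)" "\<alpha> \<in> base"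
  shows "c \<alpha> = d \<alpha>"
proof -
  have "(\<Sum>\<alpha>\<in>base. (c \<alpha> - d \<alpha>) * \<alpha> x) = 0" for x
    using fun_cong[OF assms(1), of x] by (simp add: left_diff_distrib sum_subtractf)
  then show ?thesis
    using base_independent[of "\<lambda>\<alpha>. c \<alpha> - d \<alpha>"] assms(2) by simp
qed

lemma pos_roots_subset: "pos_roots \<subseteq> R"
  by (auto simp: pos_roots_def)

lemma pos_root: "\<beta> \<in> pos_roots \<Longrightarrow> \<beta> \<in> R"
  by (auto simp: pos_roots_def)

lemma finite_pos_roots: "finite pos_roots"
  using pos_roots_subset finite_roots finite_subset by blast

lemma pos_or_neg: "\<beta> \<in> R \<Longrightarrow> \<beta> \<in> pos_roots \<or> - \<beta> \<in> pos_roots"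
proof -
  assume \<beta>: "\<beta> \<in> R"
  obtain m :: "('t \<Rightarrow> complex) \<Rightarrow> nat" where
    "\<beta> = (\<lambda>x. \<Sum>\<alpha>\<in>base. of_nat (m \<alpha>) * \<alpha> x) \<or> \<beta> = (\<lambda>x. - (\<Sum>\<alpha>\<in>base. of_nat (m \<alpha>) * \<alpha> x))"
    using base_sign[OF \<beta>] by blast
  then show ?thesis
  proof
    assume "\<beta> = (\<lambda>x. \<Sum>\<alpha>\<in>base. of_nat (m \<alpha>) * \<alpha> x)"
    then show ?thesis using \<beta> unfolding pos_roots_def by blast
  next
    assume "\<beta> = (\<lambda>x. - (\<Sum>\<alpha>\<in>base. of_nat (m \<alpha>) * \<alpha> x))"
    then have "- \<beta> = (\<lambda>x. \<Sum>\<alpha>\<in>base. of_nat (m \<alpha>) * \<alpha> x)"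
      by (auto simp: fun_eq_iff)
    then show ?thesis using root_minus[OF \<beta>] unfolding pos_roots_def by blast
  qed
qed

lemma not_pos_and_neg:
  assumes "\<beta> \<in> pos_roots" "- \<beta> \<in> pos_roots"
  shows False
proof -
  obtain m n :: "('t \<Rightarrow> complex) \<Rightarrow> nat" where
    m: "\<beta> = (\<lambda>x. \<Sum>\<alpha>\<in>base. of_nat (m \<alpha>) * \<alpha> x)" and
    n: "- \<beta> = (\<lambda>x. \<Sum>\<alpha>\<in>base. of_nat (n \<alpha>) * \<alpha> x)"
    using assms unfolding pos_roots_def by blast
  \<comment> \<open>Adding the two expansions gives coefficients that are natural numbers and must
    vanish, so no order on the complex numbers is needed.\<close>
  have eq: "(\<lambda>x. \<Sum>\<alpha>\<in>base. of_nat (m \<alpha> + n \<alpha>) * \<alpha> x) = (\<lambda>x. \<Sum>\<alpha>\<in>base. 0 * \<alpha> x)"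
  proof
    fix x
    show "(\<Sum>\<alpha>\<in>base. of_nat (m \<alpha> + n \<alpha>) * \<alpha> x) = (\<Sum>\<alpha>\<in>base. 0 * \<alpha> x)"
      using fun_cong[OF m, of x] fun_cong[OF n, of x]
      by (simp add: distrib_right sum.distrib add_eq_0_iff)
  qed
  have "(of_nat (m \<alpha> + n \<alpha>) :: complex) = 0" if "\<alpha> \<in> base" for \<alpha>
    by (rule base_combination_inject[OF eq that])
  then have "m \<alpha> = 0" if "\<alpha> \<in> base" for \<alpha>
    using that by (simp only: of_nat_eq_0_iff add_is_0)
  then have "\<beta> = 0"
    by (subst m) (auto simp: fun_eq_iff)
  then show False
    using root_nonzero assms pos_root by auto
qed

lemma base_pos: "\<alpha> \<in> base \<Longrightarrow> \<alpha> \<in> pos_roots"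
proof -
  assume \<alpha>: "\<alpha> \<in> base"
  have "(\<Sum>\<gamma>\<in>base. of_nat (if \<gamma> = \<alpha> then 1 else 0) * \<gamma> x) = \<alpha> x" for x
  proof -
    have "(\<Sum>\<gamma>\<in>base. of_nat (if \<gamma> = \<alpha> then 1 else 0) * \<gamma> x) = (\<Sum>\<gamma>\<in>base. if \<gamma> = \<alpha> then \<alpha> x else 0)"
      by (intro sum.cong) auto
    then show ?thesis using \<alpha> finite_base by simp
  qed
  then have "\<alpha> = (\<lambda>x. \<Sum>\<gamma>\<in>base. of_nat (if \<gamma> = \<alpha> then 1 else 0) * \<gamma> x)"
    by (intro ext) simp
  then have "\<exists>m :: ('t \<Rightarrow> complex) \<Rightarrow> nat. \<alpha> = (\<lambda>x. \<Sum>\<gamma>\<in>base. of_nat (m \<gamma>) * \<gamma> x)"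
    by (rule exI[of _ "\<lambda>\<gamma>. if \<gamma> = \<alpha> then 1 else 0"])
  then show ?thesis
    using \<alpha> base_subset unfolding pos_roots_def by blast
qed

lemma base_root: "\<alpha> \<in> base \<Longrightarrow> \<alpha> \<in> R"
  using base_subset by blast

lemma combination_srefl:
  assumes \<alpha>: "\<alpha> \<in> base" and \<beta>: "\<beta> \<in> R" "\<beta> = (\<lambda>x. \<Sum>\<gamma>\<in>base. c \<gamma> * \<gamma> x)"
  shows "\<beta> \<circ> srefl \<alpha> = (\<lambda>x. \<Sum>\<gamma>\<in>base. (c \<gamma> - (if \<gamma> = \<alpha> then \<beta> (coroot \<alpha>) else 0)) * \<gamma> x)"
proof
  fix x
  have "(\<Sum>\<gamma>\<in>base. (if \<gamma> = \<alpha> then \<beta> (coroot \<alpha>) else 0) * \<gamma> x)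
      = (\<Sum>\<gamma>\<in>base. if \<gamma> = \<alpha> then \<beta> (coroot \<alpha>) * \<alpha> x else 0)"
    by (intro sum.cong) auto
  also have "\<dots> = \<beta> (coroot \<alpha>) * \<alpha> x"
    using \<alpha> finite_base by simp
  finally have e: "(\<Sum>\<gamma>\<in>base. (if \<gamma> = \<alpha> then \<beta> (coroot \<alpha>) else 0) * \<gamma> x) = \<beta> (coroot \<alpha>) * \<alpha> x" .
  have "(\<beta> \<circ> srefl \<alpha>) x = \<beta> x - \<beta> (coroot \<alpha>) * \<alpha> x"
    using root_linear[OF \<beta>(1)] by (simp add: srefl_def functional_diff functional_scale)
  also have "\<beta> x = (\<Sum>\<gamma>\<in>base. c \<gamma> * \<gamma> x)"
    using \<beta>(2) by (rule fun_cong)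
  finally show "(\<beta> \<circ> srefl \<alpha>) x = (\<Sum>\<gamma>\<in>base. (c \<gamma> - (if \<gamma> = \<alpha> then \<beta> (coroot \<alpha>) else 0)) * \<gamma> x)"
    unfolding left_diff_distrib sum_subtractf e .
qed

text \<open>The reflection in \<alpha> changes only the coefficient at \<alpha>. If the image were
  negative, all other coefficients of \<beta> would vanish, and reducedness would leave only \<beta>
  = \<alpha>.\<close>

lemma simple_reflection_pos:
  assumes \<alpha>: "\<alpha> \<in> base" and \<beta>: "\<beta> \<in> pos_roots" and ne: "\<beta> \<noteq> \<alpha>"
  shows "\<beta> \<circ> srefl \<alpha> \<in> pos_roots"
proof (rule ccontr)
  assume "\<beta> \<circ> srefl \<alpha> \<notin> pos_roots"
  then have "- (\<beta> \<circ> srefl \<alpha>) \<in> pos_roots"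
    using pos_or_neg root_comp_srefl[OF base_root[OF \<alpha>] pos_root[OF \<beta>]] by blast
  then obtain n :: "('t \<Rightarrow> complex) \<Rightarrow> nat" where
    n: "- (\<beta> \<circ> srefl \<alpha>) = (\<lambda>x. \<Sum>\<gamma>\<in>base. of_nat (n \<gamma>) * \<gamma> x)"
    unfolding pos_roots_def by blast
  obtain m :: "('t \<Rightarrow> complex) \<Rightarrow> nat" where
    m: "\<beta> = (\<lambda>x. \<Sum>\<gamma>\<in>base. of_nat (m \<gamma>) * \<gamma> x)"
    using \<beta> unfolding pos_roots_def by blast
  define c where "c \<gamma> = of_nat (m \<gamma>) - (if \<gamma> = \<alpha> then \<beta> (coroot \<alpha>) else 0)" for \<gamma>
  have "\<beta> \<circ> srefl \<alpha> = (\<lambda>x. \<Sum>\<gamma>\<in>base. c \<gamma> * \<gamma> x)"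
    unfolding c_def using combination_srefl[OF \<alpha> pos_root[OF \<beta>] m] .
  then have eq: "(\<lambda>x. \<Sum>\<gamma>\<in>base. c \<gamma> * \<gamma> x) = (\<lambda>x. \<Sum>\<gamma>\<in>base. - of_nat (n \<gamma>) * \<gamma> x)"
    using fun_cong[OF n] by (auto simp: fun_eq_iff sum_negf) (metis add.inverse_inverse)
  have "of_nat (n \<gamma>) = - c \<gamma>" if "\<gamma> \<in> base" for \<gamma>
    using base_combination_inject[OF eq that] by simp
  then have mn: "(of_nat (m \<gamma> + n \<gamma>) :: complex) = 0" if "\<gamma> \<in> base" "\<gamma> \<noteq> \<alpha>" for \<gamma>
    using that by (simp add: c_def)
  have m0: "m \<gamma> = 0" if "\<gamma> \<in> base" "\<gamma> \<noteq> \<alpha>" for \<gamma>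
    using mn[OF that] by (simp only: of_nat_eq_0_iff add_is_0)
  have "\<beta> = (\<lambda>x. of_nat (m \<alpha>) * \<alpha> x)"
  proof
    fix x
    have "\<beta> x = (\<Sum>\<gamma>\<in>base. of_nat (m \<gamma>) * \<gamma> x)"
      using m by (rule fun_cong)
    also have "\<dots> = (\<Sum>\<gamma>\<in>base. if \<gamma> = \<alpha> then of_nat (m \<alpha>) * \<alpha> x else 0)"
      using m0 by (intro sum.cong) auto
    finally show "\<beta> x = of_nat (m \<alpha>) * \<alpha> x"
      using \<alpha> finite_base by simp
  qed
  moreover from this have "(of_nat (m \<alpha>) :: complex) = 1 \<or> (of_nat (m \<alpha>) :: complex) = - 1"
    using reduced[OF base_root[OF \<alpha>], of "of_nat (m \<alpha>)"] pos_root[OF \<beta>] by metis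
  moreover have "(of_nat (m \<alpha>) :: complex) \<noteq> - 1"
    by (metis of_nat_neq_0 add.left_inverse add.commute of_nat_Suc)
  ultimately show False
    using ne by (auto simp: fun_eq_iff)
qed

text \<open>The form \<open>\<Sum>\<^bsub>\<gamma>\<^esub> \<gamma>(x) \<gamma>(y)\<close> is invariant and positive on coroots.\<close>

lemma cartan_symmetrizer:
  obtains Q :: "('t \<Rightarrow> complex) \<Rightarrow> int"
  where "\<And>\<alpha>. \<alpha> \<in> R \<Longrightarrow> Q \<alpha> > 0"
    and "\<And>\<alpha> \<beta>. \<alpha> \<in> R \<Longrightarrow> \<beta> \<in> R \<Longrightarrow> \<beta> (coroot \<alpha>) * of_int (Q \<beta>) = \<alpha> (coroot \<beta>) * of_int (Q \<alpha>)"
proof -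
  define B where "B x y = (\<Sum>\<gamma>\<in>R. \<gamma> x * \<gamma> y)" for x y
  have inv: "B (srefl \<alpha> x) (srefl \<alpha> y) = B x y" if "\<alpha> \<in> R" for \<alpha> x y
    unfolding B_def
    by (rule sum.reindex_bij_witness[of _ "\<lambda>\<gamma>. \<gamma> \<circ> srefl \<alpha>" "\<lambda>\<gamma>. \<gamma> \<circ> srefl \<alpha>"])
      (use that root_comp_srefl srefl_srefl in \<open>auto simp: fun_eq_iff\<close>)
  have comm: "B x y = B y x" for x y
    by (simp add: B_def mult.commute)
  have root_B: "\<alpha> x * B (coroot \<alpha>) (coroot \<alpha>) = 2 * B x (coroot \<alpha>)" if \<alpha>: "\<alpha> \<in> R" for \<alpha> x
  proof -
    have "srefl \<alpha> (coroot \<alpha>) = - coroot \<alpha>"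
      using coroot_two[OF \<alpha>] by (simp add: srefl_def scale_left_distrib[of 1 1, simplified])
    then have "B x (coroot \<alpha>) = B (srefl \<alpha> x) (- coroot \<alpha>)"
      using inv[OF \<alpha>, of x "coroot \<alpha>"] by simp
    also have "\<dots> = (\<Sum>\<gamma>\<in>R. \<alpha> x * (\<gamma> (coroot \<alpha>) * \<gamma> (coroot \<alpha>)) - \<gamma> x * \<gamma> (coroot \<alpha>))"
      unfolding B_def
    proof (rule sum.cong)
      fix \<gamma> assume "\<gamma> \<in> R"
      then show "\<gamma> (srefl \<alpha> x) * \<gamma> (- coroot \<alpha>)
          = \<alpha> x * (\<gamma> (coroot \<alpha>) * \<gamma> (coroot \<alpha>)) - \<gamma> x * \<gamma> (coroot \<alpha>)"
        using root_linear[of \<gamma>]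
        by (simp add: srefl_def functional_diff functional_scale functional_minus algebra_simps)
    qed simp
    also have "\<dots> = \<alpha> x * B (coroot \<alpha>) (coroot \<alpha>) - B x (coroot \<alpha>)"
      by (simp add: B_def sum_subtractf sum_distrib_left)
    finally show ?thesis by (simp add: algebra_simps)
  qed
  \<comment> \<open>The pairings of roots with coroots are integers, so the floors of real parts are
    exact. Moving the norm into the integers makes its positivity expressible.\<close>
  define Q where "Q \<alpha> = (\<Sum>\<gamma>\<in>R. \<lfloor>Re (\<gamma> (coroot \<alpha>))\<rfloor> ^ 2)" for \<alpha>
  have QB: "of_int (Q \<alpha>) = B (coroot \<alpha>) (coroot \<alpha>)" if \<alpha>: "\<alpha> \<in> R" for \<alpha>
    unfolding Q_def B_def of_int_sum
  proof (rule sum.cong)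
    fix \<gamma> assume "\<gamma> \<in> R"
    then obtain k where "\<gamma> (coroot \<alpha>) = of_int k"
      using crystallographic[OF \<alpha>] by (auto elim: Ints_cases)
    then show "of_int (\<lfloor>Re (\<gamma> (coroot \<alpha>))\<rfloor> ^ 2) = \<gamma> (coroot \<alpha>) * \<gamma> (coroot \<alpha>)"
      by (simp add: power2_eq_square)
  qed simp
  have "Q \<alpha> > 0" if \<alpha>: "\<alpha> \<in> R" for \<alpha>
    unfolding Q_def
    by (rule sum_pos2[OF finite_roots \<alpha>]) (simp_all add: coroot_two[OF \<alpha>])
  moreover have "\<beta> (coroot \<alpha>) * of_int (Q \<beta>) = \<alpha> (coroot \<beta>) * of_int (Q \<alpha>)"
    if "\<alpha> \<in> R" "\<beta> \<in> R" for \<alpha> \<beta>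
    unfolding QB[OF that(1)] QB[OF that(2)] root_B[OF that(1)] root_B[OF that(2)]
    by (simp only: comm[of "coroot \<alpha>" "coroot \<beta>"])
  ultimately show thesis by (rule that)
qed

text \<open>Expanding \<beta> in simple roots writes \<open>\<beta> (coroot \<beta>) = 2\<close> as
  a nonnegative combination of the \<open>\<alpha> (coroot \<beta>)\<close>. By the symmetrizer each
  of these has the sign of \<open>\<beta> (coroot \<alpha>)\<close>, so not all can be
  nonpositive.\<close>

lemma exists_simple_positive_pairing:
  assumes \<beta>: "\<beta> \<in> pos_roots"
  shows "\<exists>\<alpha>\<in>base. \<exists>k :: int. k > 0 \<and> \<beta> (coroot \<alpha>) = of_int k"
proof (rule ccontr)
  assume neg: "\<not> ?thesis"
  obtain Q where Q: "\<And>\<alpha>. \<alpha> \<in> R \<Longrightarrow> Q \<alpha> > 0"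
    and sym: "\<And>\<alpha> \<beta>. \<alpha> \<in> R \<Longrightarrow> \<beta> \<in> R \<Longrightarrow> \<beta> (coroot \<alpha>) * of_int (Q \<beta>) = \<alpha> (coroot \<beta>) * of_int (Q \<alpha>)"
    using cartan_symmetrizer by blast
  obtain m :: "('t \<Rightarrow> complex) \<Rightarrow> nat" where
    m: "\<beta> = (\<lambda>x. \<Sum>\<gamma>\<in>base. of_nat (m \<gamma>) * \<gamma> x)"
    using \<beta> unfolding pos_roots_def by blast
  have le: "Re (\<alpha> (coroot \<beta>)) \<le> 0" if \<alpha>: "\<alpha> \<in> base" for \<alpha>
  proof -
    obtain k where k: "\<beta> (coroot \<alpha>) = of_int k"
      using crystallographic[OF base_root[OF \<alpha>] pos_root[OF \<beta>]] by (auto elim: Ints_cases)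
    obtain l where l: "\<alpha> (coroot \<beta>) = of_int l"
      using crystallographic[OF pos_root[OF \<beta>] base_root[OF \<alpha>]] by (auto elim: Ints_cases)
    have "(of_int (k * Q \<beta>) :: complex) = of_int (l * Q \<alpha>)"
      using sym[OF base_root[OF \<alpha>] pos_root[OF \<beta>]] by (simp add: k l)
    then have kl: "k * Q \<beta> = l * Q \<alpha>"
      by (simp only: of_int_eq_iff)
    have "k \<le> 0"
      using neg k \<alpha> by force
    then have "l * Q \<alpha> \<le> 0"
      using Q[OF pos_root[OF \<beta>]] kl by (metis mult_nonpos_nonneg less_imp_le)
    then have "l \<le> 0"
      using Q[OF base_root[OF \<alpha>]] by (simp add: mult_le_0_iff)
    then show ?thesis by (simp add: l)
  qed
  have "2 = Re (\<beta> (coroot \<beta>))"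
    using coroot_two[OF pos_root[OF \<beta>]] by simp
  also have "\<beta> (coroot \<beta>) = (\<Sum>\<gamma>\<in>base. of_nat (m \<gamma>) * \<gamma> (coroot \<beta>))"
    using m by (rule fun_cong)
  also have "Re \<dots> = (\<Sum>\<gamma>\<in>base. of_nat (m \<gamma>) * Re (\<gamma> (coroot \<beta>)))"
    by simp
  also have "\<dots> \<le> 0"
    using le by (intro sum_nonpos) (simp add: mult_nonneg_nonpos)
  finally show False by simp
qed

section \<open>Words in simple reflections\<close>

primrec word :: "('t \<Rightarrow> complex) list \<Rightarrow> 't \<Rightarrow> 't"
  where "word [] = id" | "word (\<alpha> # as) = srefl \<alpha> \<circ> word as"

lemma len_word: "len w = (LEAST n. \<exists>as. length as = n \<and> set as \<subseteq> base \<and> w = word as)"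
proof -
  have "foldr (\<lambda>\<alpha> v. srefl \<alpha> \<circ> v) as id = word as" for as
    by (induction as) simp_all
  then show ?thesis by (simp only: len_def)
qed

lemma word_append: "word (as @ bs) = word as \<circ> word bs"
  by (induction as) (simp_all add: o_assoc)

lemma word_weyl: "set as \<subseteq> base \<Longrightarrow> word as \<in> weyl"
  by (induction as) (simp_all add: weyl.one weyl.step base_root)

lemma inv_word: "set as \<subseteq> base \<Longrightarrow> inv (word as) = word (rev as)"
proof (induction as)
  case (Cons a as)
  then have "inv (srefl a \<circ> word as) = inv (word as) \<circ> srefl a"
    using o_inv_distrib[of "srefl a" "word as"] srefl_bij[OF base_root] weyl_bij[OF word_weyl] inv_srefl[OF base_root]
    by simp
  then show "inv (word (a # as)) = word (rev (a # as))"
    using Cons by (simp add: word_append)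
qed simp

text \<open>The group is generated by all reflections but \<open>len\<close> counts simple ones. The
  induction is on the height of \<beta>: a simple root pairing positively with a non-simple \<beta>
  reflects it to a positive root of smaller height, and conjugating back adds one letter at each
  end.\<close>

lemma srefl_pos_word:
  assumes "\<beta> \<in> pos_roots"
  shows "\<exists>as. set as \<subseteq> base \<and> srefl \<beta> = word as"
proof -
  obtain m0 :: "('t \<Rightarrow> complex) \<Rightarrow> nat" where
    "\<beta> = (\<lambda>x. \<Sum>\<gamma>\<in>base. of_nat (m0 \<gamma>) * \<gamma> x)"
    using assms unfolding pos_roots_def by blast
  with assms show ?thesis
  proof (induction "\<Sum>\<gamma>\<in>base. m0 \<gamma>" arbitrary: \<beta> m0 rule: less_induct)
    case (less m \<beta>)
    show ?case
    proof (cases "\<beta> \<in> base")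
      case True
      then show ?thesis by (intro exI[of _ "[\<beta>]"]) simp
    next
      case False
      obtain \<alpha> k where \<alpha>: "\<alpha> \<in> base" and k: "k > 0" "\<beta> (coroot \<alpha>) = of_int k"
        using exists_simple_positive_pairing[OF less.prems(1)] by blast
      have "\<beta> \<circ> srefl \<alpha> \<in> pos_roots"
        using simple_reflection_pos[OF \<alpha> less.prems(1)] False \<alpha> by blast
      moreover from this obtain n :: "('t \<Rightarrow> complex) \<Rightarrow> nat" where
        n: "\<beta> \<circ> srefl \<alpha> = (\<lambda>x. \<Sum>\<gamma>\<in>base. of_nat (n \<gamma>) * \<gamma> x)"
        unfolding pos_roots_def by blast
      moreover have "(\<Sum>\<gamma>\<in>base. n \<gamma>) < (\<Sum>\<gamma>\<in>base. m \<gamma>)"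
      proof (rule sum_strict_mono_ex1[OF finite_base])
        have eq': "(\<lambda>x. \<Sum>\<gamma>\<in>base. of_nat (n \<gamma>) * \<gamma> x)
          = (\<lambda>x. \<Sum>\<gamma>\<in>base. (of_nat (m \<gamma>) - (if \<gamma> = \<alpha> then \<beta> (coroot \<alpha>) else 0)) * \<gamma> x)"
          using combination_srefl[OF \<alpha> pos_root[OF less.prems(1)] less.prems(2)] n by simp
        have eq: "(of_nat (n \<gamma>) :: complex) = of_nat (m \<gamma>) - (if \<gamma> = \<alpha> then \<beta> (coroot \<alpha>) else 0)"
          if "\<gamma> \<in> base" for \<gamma>
          using base_combination_inject[OF eq' that] .
        have "(of_int (int (n \<alpha>)) :: complex) = of_int (int (m \<alpha>) - k)"
          using eq[OF \<alpha>] k by simp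
        then have "int (n \<alpha>) = int (m \<alpha>) - k"
          by (simp only: of_int_eq_iff)
        then have "n \<alpha> < m \<alpha>" using k by simp
        moreover have "n \<gamma> = m \<gamma>" if "\<gamma> \<in> base" "\<gamma> \<noteq> \<alpha>" for \<gamma>
          using eq[OF that(1)] that(2) by simp
        ultimately show "\<forall>\<gamma>\<in>base. n \<gamma> \<le> m \<gamma>" "\<exists>\<gamma>\<in>base. n \<gamma> < m \<gamma>"
          using \<alpha> by (auto intro: less_imp_le) (metis less_imp_le order_refl)
      qed
      ultimately obtain as where as: "set as \<subseteq> base" "srefl (\<beta> \<circ> srefl \<alpha>) = word as"
        using less.hyps by blast
      have "srefl \<beta> = srefl \<alpha> \<circ> srefl (\<beta> \<circ> srefl \<alpha>) \<circ> srefl \<alpha>"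
        using srefl_comp_srefl[OF base_root[OF \<alpha>] pos_root[OF less.prems(1)]] srefl_srefl[OF base_root[OF \<alpha>]]
        by (simp add: fun_eq_iff)
      also have "\<dots> = word (\<alpha> # as @ [\<alpha>])"
        unfolding as(2) by (simp add: word_append o_assoc)
      finally show ?thesis
        using as \<alpha> by (intro exI[of _ "\<alpha> # as @ [\<alpha>]"]) simp
    qed
  qed
qed

lemma srefl_word: "\<beta> \<in> R \<Longrightarrow> \<exists>as. set as \<subseteq> base \<and> srefl \<beta> = word as"
  using pos_or_neg[of \<beta>] srefl_pos_word[of \<beta>] srefl_pos_word[of "- \<beta>"] srefl_minus[of \<beta>] by auto

lemma weyl_word: "w \<in> weyl \<Longrightarrow> \<exists>as. set as \<subseteq> base \<and> w = word as"
proof (induction rule: weyl.induct)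
  case one
  show "\<exists>as. set as \<subseteq> base \<and> id = word as" by (intro exI[of _ "[]"]) simp
next
  case (step \<beta> w)
  from step.IH obtain as where "set as \<subseteq> base" "w = word as" by blast
  moreover obtain bs where "set bs \<subseteq> base" "srefl \<beta> = word bs"
    using srefl_word step.hyps by blast
  ultimately show "\<exists>as. set as \<subseteq> base \<and> srefl \<beta> \<circ> w = word as"
    by (intro exI[of _ "bs @ as"]) (simp add: word_append)
qed

lemma len_word_le: "set as \<subseteq> base \<Longrightarrow> len (word as) \<le> length as"
  unfolding len_word by (rule Least_le) blast

lemma reduced_word:
  assumes "w \<in> weyl"
  obtains as where "length as = len w" "set as \<subseteq> base" "w = word as"
proof -
  have "\<exists>n as. length as = n \<and> set as \<subseteq> base \<and> w = word as"
    using weyl_word[OF assms] by blast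
  from LeastI_ex[OF this] show thesis
    using that unfolding len_word by blast
qed

lemma len_id: "len id = 0"
  using len_word_le[of "[]"] by simp

lemma len_eq_0: "w \<in> weyl \<Longrightarrow> len w = 0 \<Longrightarrow> w = id"
  by (erule reduced_word) simp

lemma len_comp_le:
  assumes "v \<in> weyl" "w \<in> weyl"
  shows "len (v \<circ> w) \<le> len v + len w"
proof -
  obtain as where "length as = len v" "set as \<subseteq> base" "v = word as"
    by (rule reduced_word[OF assms(1)])
  moreover obtain bs where "length bs = len w" "set bs \<subseteq> base" "w = word bs"
    by (rule reduced_word[OF assms(2)])
  ultimately show ?thesis
    using len_word_le[of "as @ bs"] by (simp add: word_append)
qed

lemma len_inv:
  assumes "w \<in> weyl"
  shows "len (inv w) = len w"
proof -
  have *: "len (inv v) \<le> len v" if v: "v \<in> weyl" for v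
  proof -
    obtain as where "length as = len v" "set as \<subseteq> base" "v = word as"
      by (rule reduced_word[OF v])
    then show ?thesis
      using len_word_le[of "rev as"] inv_word by simp
  qed
  show ?thesis
    using *[OF assms] *[OF weyl_inv[OF assms]] weyl_inv_inv[OF assms] by simp
qed

text \<open>Push \<gamma> through the letters from the left. It ends negative, and a simple
  reflection makes a positive root negative only if that root is the letter itself. Multiplying by
  \<open>srefl \<gamma>\<close> deletes exactly that letter.\<close>

lemma strong_exchange:
  assumes "\<gamma> \<in> pos_roots" "set as \<subseteq> base" "- (\<gamma> \<circ> word as) \<in> pos_roots"
  shows "\<exists>bs. set bs \<subseteq> base \<and> Suc (length bs) = length as \<and> srefl \<gamma> \<circ> word as = word bs"
  using assms
proof (induction as arbitrary: \<gamma>)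
  case Nil
  then have "- \<gamma> \<in> pos_roots" by (simp add: fun_Compl_def)
  then show ?case using not_pos_and_neg Nil by blast
next
  case (Cons a as)
  have neg: "- (\<gamma> \<circ> srefl a \<circ> word as) \<in> pos_roots"
    using Cons.prems(3) by (simp add: o_def fun_Compl_def)
  show "\<exists>bs. set bs \<subseteq> base \<and> Suc (length bs) = length (a # as) \<and> srefl \<gamma> \<circ> word (a # as) = word bs"
  proof (cases "\<gamma> = a")
    case True
    then have "srefl \<gamma> \<circ> word (a # as) = word as"
      using srefl_involution[OF pos_root[OF Cons.prems(1)]] by (simp add: o_assoc)
    then show ?thesis using Cons.prems by (intro exI[of _ as]) simp
  next
    case False
    have a: "a \<in> base" using Cons.prems by simp
    have p: "\<gamma> \<circ> srefl a \<in> pos_roots"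
      using simple_reflection_pos[OF a Cons.prems(1) False] .
    have "set as \<subseteq> base" using Cons.prems(2) by simp
    from Cons.IH[OF p this neg] obtain bs where bs: "set bs \<subseteq> base" "Suc (length bs) = length as"
      "srefl (\<gamma> \<circ> srefl a) \<circ> word as = word bs"
      by blast
    have "srefl \<gamma> \<circ> word (a # as) = srefl a \<circ> (srefl (\<gamma> \<circ> srefl a) \<circ> word as)"
      using srefl_comp_srefl[OF base_root[OF a] pos_root[OF Cons.prems(1)]] srefl_srefl[OF base_root[OF a]]
      by (simp add: fun_eq_iff)
    also have "\<dots> = word (a # bs)"
      unfolding bs(3) by simp
    finally show ?thesis
      using bs a by (intro exI[of _ "a # bs"]) simp
  qed
qed

lemma len_srefl_less:
  assumes "\<gamma> \<in> pos_roots" "u \<in> weyl" "- (\<gamma> \<circ> u) \<in> pos_roots"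
  shows "len (srefl \<gamma> \<circ> u) < len u"
proof -
  obtain as where as: "length as = len u" "set as \<subseteq> base" "u = word as"
    by (rule reduced_word[OF assms(2)])
  then obtain bs where "set bs \<subseteq> base" "Suc (length bs) = length as" "srefl \<gamma> \<circ> u = word bs"
    using strong_exchange[of \<gamma> as] assms by metis
  then show ?thesis
    using len_word_le[of bs] as by simp
qed

lemma srefl_cancel: "\<gamma> \<in> R \<Longrightarrow> srefl \<gamma> \<circ> (srefl \<gamma> \<circ> u) = u"
  by (simp add: o_assoc srefl_involution)

lemma len_srefl_greater:
  assumes "\<gamma> \<in> pos_roots" "u \<in> weyl" "\<gamma> \<circ> u \<in> pos_roots"
  shows "len u < len (srefl \<gamma> \<circ> u)"
proof -
  have "- (\<gamma> \<circ> (srefl \<gamma> \<circ> u)) = \<gamma> \<circ> u"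
    using root_comp_self[OF pos_root[OF assms(1)]] by (simp add: o_assoc fun_eq_iff)
  then show ?thesis
    using len_srefl_less[of \<gamma> "srefl \<gamma> \<circ> u"] assms weyl.step[OF pos_root[OF assms(1)] assms(2)]
    by (simp only: srefl_cancel[OF pos_root])
qed

section \<open>Inversions and length\<close>

definition inversions :: "('t \<Rightarrow> 't) \<Rightarrow> ('t \<Rightarrow> complex) set"
  where "inversions u = {\<beta> \<in> pos_roots. - (\<beta> \<circ> u) \<in> pos_roots}"

lemma finite_inversions: "finite (inversions u)"
  using finite_pos_roots by (simp add: inversions_def)

text \<open>The reflection in \<alpha> permutes the positive roots other than \<alpha>, so \<alpha>
  is the only new inversion. Disjointness and injectivity are recorded because the set is used both
  for a cardinality and for a product.\<close>

lemma inversions_srefl: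
  assumes \<alpha>: "\<alpha> \<in> base" and u: "u \<in> weyl" "\<alpha> \<circ> u \<in> pos_roots"
  shows "inversions (srefl \<alpha> \<circ> u) = insert \<alpha> ((\<lambda>\<beta>. \<beta> \<circ> srefl \<alpha>) ` inversions u)"
    and "\<alpha> \<notin> (\<lambda>\<beta>. \<beta> \<circ> srefl \<alpha>) ` inversions u"
    and "inj_on (\<lambda>\<beta>. \<beta> \<circ> srefl \<alpha>) (inversions u)"
proof -
  have inv: "\<beta> \<circ> srefl \<alpha> \<circ> srefl \<alpha> = \<beta>" for \<beta> :: "'t \<Rightarrow> complex"
    using srefl_srefl[OF base_root[OF \<alpha>]] by (simp add: fun_eq_iff)
  show "inj_on (\<lambda>\<beta>. \<beta> \<circ> srefl \<alpha>) (inversions u)"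
    by (metis inj_onI inv)
  show "\<alpha> \<notin> (\<lambda>\<beta>. \<beta> \<circ> srefl \<alpha>) ` inversions u"
  proof
    assume "\<alpha> \<in> (\<lambda>\<beta>. \<beta> \<circ> srefl \<alpha>) ` inversions u"
    then obtain \<beta> where "\<beta> \<in> pos_roots" "\<alpha> = \<beta> \<circ> srefl \<alpha>"
      by (auto simp: inversions_def)
    then have "\<beta> = - \<alpha>"
      using inv root_comp_self[OF base_root[OF \<alpha>]] by metis
    then show False
      using not_pos_and_neg base_pos[OF \<alpha>] \<open>\<beta> \<in> pos_roots\<close> by blast
  qed
  show "inversions (srefl \<alpha> \<circ> u) = insert \<alpha> ((\<lambda>\<beta>. \<beta> \<circ> srefl \<alpha>) ` inversions u)"
  proof (intro equalityI subsetI)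
    fix \<beta> assume "\<beta> \<in> inversions (srefl \<alpha> \<circ> u)"
    then have \<beta>: "\<beta> \<in> pos_roots" "- (\<beta> \<circ> srefl \<alpha> \<circ> u) \<in> pos_roots"
      by (simp_all add: inversions_def o_assoc)
    show "\<beta> \<in> insert \<alpha> ((\<lambda>\<beta>. \<beta> \<circ> srefl \<alpha>) ` inversions u)"
    proof (cases "\<beta> = \<alpha>")
      case False
      then have "\<beta> \<circ> srefl \<alpha> \<in> inversions u"
        using simple_reflection_pos[OF \<alpha> \<beta>(1)] \<beta>(2) by (simp add: inversions_def)
      then show ?thesis using inv by (metis image_eqI insertCI)
    qed simp
  next
    fix \<beta> assume "\<beta> \<in> insert \<alpha> ((\<lambda>\<beta>. \<beta> \<circ> srefl \<alpha>) ` inversions u)"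
    then consider "\<beta> = \<alpha>" | \<gamma> where "\<gamma> \<in> inversions u" "\<beta> = \<gamma> \<circ> srefl \<alpha>" by blast
    then show "\<beta> \<in> inversions (srefl \<alpha> \<circ> u)"
    proof cases
      case 1
      have "- (\<alpha> \<circ> (srefl \<alpha> \<circ> u)) = \<alpha> \<circ> u"
        using root_comp_self[OF base_root[OF \<alpha>]] by (simp add: o_assoc fun_eq_iff)
      then show ?thesis
        using 1 base_pos[OF \<alpha>] u by (simp only: inversions_def mem_Collect_eq)
    next
      case 2
      then have \<gamma>: "\<gamma> \<in> pos_roots" "- (\<gamma> \<circ> u) \<in> pos_roots" by (simp_all add: inversions_def)
      then have "\<gamma> \<noteq> \<alpha>" using u not_pos_and_neg by blast
      then have "\<beta> \<in> pos_roots" using simple_reflection_pos[OF \<alpha> \<gamma>(1)] 2 by simp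
      moreover have "\<beta> \<circ> (srefl \<alpha> \<circ> u) = \<gamma> \<circ> u"
        using 2 inv by (simp add: o_assoc)
      ultimately show ?thesis using \<gamma> by (simp only: inversions_def mem_Collect_eq)
    qed
  qed
qed

text \<open>Stripping the first letter \<alpha> of a reduced word leaves \<open>v\<close> of length
  exactly one less. If \<open>\<alpha> \<circ> v\<close> were negative, putting the letter back
  would shorten \<open>v\<close>; so it is positive and exactly one inversion is gained.\<close>

lemma len_eq_card_inversions: "u \<in> weyl \<Longrightarrow> len u = card (inversions u)"
proof (induction "len u" arbitrary: u)
  case 0
  then have "u = id" using len_eq_0 by simp
  then have "inversions u = {}" using not_pos_and_neg by (auto simp: inversions_def)
  then show ?case using 0 by simp
next
  case (Suc n)
  obtain as where as: "length as = len u" "set as \<subseteq> base" "u = word as"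
    by (rule reduced_word[OF Suc.prems])
  then obtain \<alpha> bs where ab: "as = \<alpha> # bs" using Suc.hyps by (cases as) auto
  define v where "v = word bs"
  have v: "v \<in> weyl" "len v \<le> n" and \<alpha>: "\<alpha> \<in> base" and uv: "u = srefl \<alpha> \<circ> v"
    using as ab word_weyl[of bs] len_word_le[of bs] Suc.hyps by (simp_all add: v_def)
  have "len (srefl \<alpha>) \<le> 1" using len_word_le[of "[\<alpha>]"] \<alpha> by simp
  then have "len v = n"
    using len_comp_le[OF srefl_weyl[OF base_root[OF \<alpha>]] v(1)] uv Suc.hyps v(2) by simp
  have "\<alpha> \<circ> v \<in> pos_roots"
  proof (rule ccontr)
    assume "\<alpha> \<circ> v \<notin> pos_roots"
    then have "- (\<alpha> \<circ> v) \<in> pos_roots"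
      using pos_or_neg[OF root_comp_weyl[OF v(1) base_root[OF \<alpha>]]] by simp
    then have "len u < len v"
      using len_srefl_less[OF base_pos[OF \<alpha>] v(1)] uv by simp
    then show False using \<open>len v = n\<close> Suc.hyps by simp
  qed
  from inversions_srefl[OF \<alpha> v(1) this] have "card (inversions u) = Suc (card (inversions v))"
    by (simp add: uv card_image finite_inversions)
  then show ?case using Suc.hyps v \<open>len v = n\<close> by simp
qed

lemma len_srefl_Suc:
  assumes "\<alpha> \<in> base" "u \<in> weyl" "\<alpha> \<circ> u \<in> pos_roots"
  shows "len (srefl \<alpha> \<circ> u) = Suc (len u)"
  using inversions_srefl[OF assms] weyl.step[OF base_root[OF assms(1)] assms(2)] assms(2)
  by (simp add: len_eq_card_inversions card_image finite_inversions del: o_apply)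

lemma len_srefl_pred:
  assumes "\<alpha> \<in> base" "u \<in> weyl" "- (\<alpha> \<circ> u) \<in> pos_roots"
  shows "len u = Suc (len (srefl \<alpha> \<circ> u))"
proof -
  have "\<alpha> \<circ> (srefl \<alpha> \<circ> u) = - (\<alpha> \<circ> u)"
    using root_comp_self[OF base_root[OF assms(1)]] by (simp add: o_assoc fun_eq_iff)
  then show ?thesis
    using len_srefl_Suc[OF assms(1) weyl.step[OF base_root[OF assms(1)] assms(2)]] assms(3)
    by (simp only: srefl_cancel[OF base_root[OF assms(1)]])
qed

text \<open>Inversions bound the length of every reduced word. Finiteness ensures that the sums over
  weak order intervals are genuine sums.\<close>

lemma finite_weyl: "finite weyl"
proof -
  have "weyl \<subseteq> word ` {as. set as \<subseteq> base \<and> length as \<le> card pos_roots}"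
  proof
    fix u assume u: "u \<in> weyl"
    have "len u \<le> card pos_roots"
      using len_eq_card_inversions[OF u] card_mono[OF finite_pos_roots, of "inversions u"]
      by (auto simp: inversions_def)
    with u show "u \<in> word ` {as. set as \<subseteq> base \<and> length as \<le> card pos_roots}"
      using reduced_word[OF u] by (metis (mono_tags, lifting) image_eqI mem_Collect_eq)
  qed
  then show ?thesis
    using finite_lists_length_le[OF finite_base] finite_surj by blast
qed

subsection \<open>Homogeneous polynomial functions\<close>

lemma Sym_deg_const: "(\<lambda>_. c) \<in> Sym_deg 0"
  by (simp add: Sym_deg_def Sym_deg_graph.const)

lemma Sym_deg_mult: "functional \<mu> \<Longrightarrow> p \<in> Sym_deg d \<Longrightarrow> \<mu> * p \<in> Sym_deg (Suc d)"
  by (simp add: Sym_deg_def Sym_deg_graph.mult)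

lemma Sym_deg_add: "p \<in> Sym_deg d \<Longrightarrow> q \<in> Sym_deg d \<Longrightarrow> p + q \<in> Sym_deg d"
  by (simp add: Sym_deg_def Sym_deg_graph.add)

lemma Sym_deg_induct [consumes 1, case_names const mult add]:
  assumes "p \<in> Sym_deg d"
    and "\<And>c. P 0 (\<lambda>_. c)"
    and "\<And>\<mu> d p. functional \<mu> \<Longrightarrow> p \<in> Sym_deg d \<Longrightarrow> P d p \<Longrightarrow> P (Suc d) (\<mu> * p)"
    and "\<And>d p q. p \<in> Sym_deg d \<Longrightarrow> P d p \<Longrightarrow> q \<in> Sym_deg d \<Longrightarrow> P d q \<Longrightarrow> P d (p + q)"
  shows "P d p"
  using assms(1) unfolding Sym_deg_def mem_Collect_eq
  by (rule Sym_deg_graph.induct) (fact assms(2-)[unfolded Sym_deg_def mem_Collect_eq])+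

lemma Sym_deg_zero: "0 \<in> Sym_deg d"
proof (induction d)
  case 0
  show "0 \<in> Sym_deg 0" using Sym_deg_const[of 0] by (simp add: zero_fun_def)
next
  case (Suc d)
  have "functional 0" by (simp add: functional_iff)
  from Sym_deg_mult[OF this Suc] show "0 \<in> Sym_deg (Suc d)" by simp
qed

lemma Sym_deg_smult:
  assumes "p \<in> Sym_deg d"
  shows "(\<lambda>_. c) * p \<in> Sym_deg d"
  using assms
proof (induction rule: Sym_deg_induct)
  case (const k)
  then show ?case using Sym_deg_const[of "c * k"] by (simp add: times_fun_def)
next
  case (mult \<mu> d p)
  have "(\<lambda>_. c) * (\<mu> * p) = \<mu> * ((\<lambda>_. c) * p)" by (simp add: algebra_simps)
  then show ?case using Sym_deg_mult[OF mult(1,3)] by metis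
next
  case (add d p q)
  then show ?case using Sym_deg_add by (metis distrib_left)
qed

lemma Sym_deg_diff:
  assumes "p \<in> Sym_deg d" "q \<in> Sym_deg d"
  shows "p - q \<in> Sym_deg d"
proof -
  have "p - q = p + (\<lambda>_. - 1) * q" by (simp add: fun_eq_iff)
  then show ?thesis using assms Sym_deg_add Sym_deg_smult by metis
qed

lemma Sym_deg_Sym: "p \<in> Sym_deg d \<Longrightarrow> p \<in> Sym"
  by (induction rule: Sym_deg_induct) (blast intro: Sym.intros)+

lemma Sym_deg_comp:
  assumes "p \<in> Sym_deg d" "endo u"
  shows "p \<circ> u \<in> Sym_deg d"
  using assms(1)
proof (induction rule: Sym_deg_induct)
  case (const c)
  then show ?case using Sym_deg_const by (simp add: o_def)
next
  case (mult \<mu> d p)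
  have "(\<mu> * p) \<circ> u = (\<mu> \<circ> u) * (p \<circ> u)" by (simp add: fun_eq_iff)
  then show ?case using Sym_deg_mult[OF functional_comp[OF mult(1) assms(2)] mult(3)] by metis
next
  case (add d p q)
  have "(p + q) \<circ> u = (p \<circ> u) + (q \<circ> u)" by (simp add: fun_eq_iff)
  then show ?case using Sym_deg_add[OF add.IH] by metis
qed

lemma Sym_deg_prod:
  assumes "finite A" "\<And>\<beta>. \<beta> \<in> A \<Longrightarrow> functional \<beta>"
  shows "(\<Prod>\<beta>\<in>A. \<beta>) \<in> Sym_deg (card A)"
  using assms
proof (induction A rule: finite_induct)
  case empty
  then show ?case using Sym_deg_const[of 1] by (simp add: one_fun_def)
next
  case (insert \<beta> A)
  then have "\<beta> * (\<Prod>\<beta>\<in>A. \<beta>) \<in> Sym_deg (Suc (card A))" by (intro Sym_deg_mult) auto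
  with insert.hyps show "(\<Prod>\<beta>\<in>insert \<beta> A. \<beta>) \<in> Sym_deg (card (insert \<beta> A))" by simp
qed

text \<open>Restriction to a line replaces questions about several variables by root counting; the
  degree bound is what limits the number of zeros.\<close>

lemma Sym_deg_line:
  assumes "p \<in> Sym_deg d"
  shows "\<exists>q :: complex poly. degree q \<le> d \<and> (\<forall>t. p (x + t *s y) = poly q t)"
  using assms
proof (induction rule: Sym_deg_induct)
  case (const c)
  show ?case by (rule exI[of _ "[:c:]"]) simp
next
  case (mult \<mu> d p)
  then obtain q where q: "degree q \<le> d" "\<And>t. p (x + t *s y) = poly q t" by blast
  have "\<mu> (x + t *s y) = poly [:\<mu> x, \<mu> y:] t" for t
    using mult(1) by (simp add: functional_add functional_scale)
  then have "(\<mu> * p) (x + t *s y) = poly ([:\<mu> x, \<mu> y:] * q) t" for t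
    using q by (simp only: times_fun_apply poly_mult)
  moreover have "degree ([:\<mu> x, \<mu> y:] * q) \<le> Suc d"
    using degree_mult_le[of "[:\<mu> x, \<mu> y:]" q] q(1) by (simp split: if_splits)
  ultimately show ?case by blast
next
  case (add d p q)
  then obtain a b where "degree a \<le> d" "\<And>t. p (x + t *s y) = poly a t"
    "degree b \<le> d" "\<And>t. q (x + t *s y) = poly b t" by blast
  then show ?case
    by (intro exI[of _ "a + b"]) (simp add: degree_add_le)
qed

section \<open>Vanishing on hyperplanes and division by linear functionals\<close>

lemma avoid_hyperplanes:
  assumes "finite F" "\<And>\<gamma>. \<gamma> \<in> F \<Longrightarrow> functional \<gamma> \<and> \<gamma> \<noteq> 0"
  shows "\<exists>y. \<forall>\<gamma>\<in>F. \<gamma> y \<noteq> 0"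
  using assms
proof (induction F rule: finite_induct)
  case (insert \<beta> F)
  then obtain y where y: "\<forall>\<gamma>\<in>F. \<gamma> y \<noteq> 0" by blast
  obtain z where z: "\<beta> z \<noteq> 0" using insert.prems[of \<beta>] by (auto simp: fun_eq_iff)
  \<comment> \<open>Each functional excludes at most one parameter \<open>t\<close>. If \<gamma> is
    zero at \<open>z\<close>, the quotient is 0 by convention, and excluding \<open>t = 0\<close> as
    well does no harm.\<close>
  have "finite (insert (- \<beta> y / \<beta> z) ((\<lambda>\<gamma>. - \<gamma> y / \<gamma> z) ` F))"
    using insert by simp
  from ex_new_if_finite[OF infinite_UNIV_char_0 this]
  obtain t where t: "t \<noteq> - \<beta> y / \<beta> z" "\<And>\<gamma>. \<gamma> \<in> F \<Longrightarrow> t \<noteq> - \<gamma> y / \<gamma> z"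
    by blast
  have "\<gamma> (y + t *s z) \<noteq> 0" if "\<gamma> \<in> insert \<beta> F" for \<gamma>
  proof
    assume "\<gamma> (y + t *s z) = 0"
    then have e: "\<gamma> y + t * \<gamma> z = 0"
      using insert.prems[OF that] by (simp add: functional_add functional_scale)
    then have "\<gamma> z \<noteq> 0" using that y z by auto
    then have "t = - \<gamma> y / \<gamma> z" using e by (simp add: field_simps add_eq_0_iff)
    then show False using t that by blast
  qed
  then show ?case by blast
qed simp

text \<open>A density argument along one line: in a direction lying in none of the hyperplanes, all
  but finitely many points of the line through \<open>x\<close> avoid them, so the restriction is
  the zero polynomial and vanishes at \<open>x\<close> too.\<close>

lemma Sym_deg_zero_off_hyperplanes:
  assumes p: "p \<in> Sym_deg d" and F: "finite F" "\<And>\<gamma>. \<gamma> \<in> F \<Longrightarrow> functional \<gamma> \<and> \<gamma> \<noteq> 0"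
    and van: "\<And>x. (\<And>\<gamma>. \<gamma> \<in> F \<Longrightarrow> \<gamma> x \<noteq> 0) \<Longrightarrow> p x = 0"
  shows "p = 0"
proof
  fix x
  obtain z where z: "\<And>\<gamma>. \<gamma> \<in> F \<Longrightarrow> \<gamma> z \<noteq> 0" using avoid_hyperplanes[OF F] by blast
  obtain q :: "complex poly" where q: "\<And>t. p (x + t *s z) = poly q t"
    using Sym_deg_line[OF p] by blast
  have "poly q t = 0" if "t \<notin> (\<lambda>\<gamma>. - \<gamma> x / \<gamma> z) ` F" for t
  proof -
    have "p (x + t *s z) = 0"
    proof (rule van)
      fix \<gamma> assume \<gamma>: "\<gamma> \<in> F"
      show "\<gamma> (x + t *s z) \<noteq> 0"
      proof
        assume "\<gamma> (x + t *s z) = 0"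
        then have "\<gamma> x + t * \<gamma> z = 0"
          using F(2)[OF \<gamma>] by (simp add: functional_add functional_scale)
        then have "t = - \<gamma> x / \<gamma> z" using z[OF \<gamma>] by (simp add: field_simps add_eq_0_iff)
        then show False using that \<gamma> by blast
      qed
    qed
    then show ?thesis using q by simp
  qed
  then have "- (\<lambda>\<gamma>. - \<gamma> x / \<gamma> z) ` F \<subseteq> {t. poly q t = 0}" by blast
  moreover have "infinite (- (\<lambda>\<gamma>. - \<gamma> x / \<gamma> z) ` F)"
    using F(1) infinite_UNIV_char_0[where 'a = complex] by (simp add: Compl_eq_Diff_UNIV)
  ultimately have "q = 0"
    using poly_roots_finite finite_subset by blast
  then show "p x = 0 x" using q[of 0] by simp
qed

text \<open>Restricted to a generic line, \<open>p\<close> is a polynomial of degree at most \<open>d\<close> with more than \<open>d\<close>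
  distinct zeros, one on each hyperplane.\<close>

lemma Sym_deg_zero_of_hyperplanes:
  assumes p: "p \<in> Sym_deg d" and S: "finite S" "d < card S"
    and lin: "\<And>\<beta>. \<beta> \<in> S \<Longrightarrow> functional \<beta> \<and> \<beta> \<noteq> 0"
    and nonprop: "\<And>\<beta> \<gamma> k. \<beta> \<in> S \<Longrightarrow> \<gamma> \<in> S \<Longrightarrow> \<beta> = (\<lambda>x. k * \<gamma> x) \<Longrightarrow> \<beta> = \<gamma>"
    and van: "\<And>\<beta> x. \<beta> \<in> S \<Longrightarrow> \<beta> x = 0 \<Longrightarrow> p x = 0"
  shows "p = 0"
proof -
  obtain y where y: "\<And>\<beta>. \<beta> \<in> S \<Longrightarrow> \<beta> y \<noteq> 0" using avoid_hyperplanes[OF S(1) lin] by blast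
  \<comment> \<open>The line through \<open>x\<close> in direction \<open>y\<close> meets the
    hyperplane of \<beta> at parameter \<open>- \<beta> x / \<beta> y\<close>. A member of
    \<open>F\<close> vanishes at \<open>x\<close> exactly when two of these parameters coincide, so
    off \<open>F\<close> the zeros are distinct.\<close>
  define F where "F = (\<lambda>(\<beta>, \<gamma>). (\<lambda>x. \<beta> y * \<gamma> x - \<gamma> y * \<beta> x)) ` {(\<beta>, \<gamma>) \<in> S \<times> S. \<beta> \<noteq> \<gamma>}"
  show ?thesis
  proof (rule Sym_deg_zero_off_hyperplanes[OF p])
    have "finite {(\<beta>, \<gamma>) \<in> S \<times> S. \<beta> \<noteq> \<gamma>}"
      using S(1) by (auto intro: finite_subset[of _ "S \<times> S"])
    then show "finite F" by (simp add: F_def)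
  next
    fix \<delta> assume "\<delta> \<in> F"
    then obtain \<beta> \<gamma> where bc: "\<beta> \<in> S" "\<gamma> \<in> S" "\<beta> \<noteq> \<gamma>" "\<delta> = (\<lambda>x. \<beta> y * \<gamma> x - \<gamma> y * \<beta> x)"
      unfolding F_def by auto
    have "functional \<delta>"
      using lin[OF bc(1)] lin[OF bc(2)] by (simp add: bc(4) functional_iff algebra_simps)
    moreover have "\<delta> \<noteq> 0"
    proof
      assume "\<delta> = 0"
      then have "\<beta> y * \<gamma> x - \<gamma> y * \<beta> x = 0" for x using bc(4) by (simp add: fun_eq_iff)
      then have "\<gamma> = (\<lambda>x. (\<gamma> y / \<beta> y) * \<beta> x)"
        using y[OF bc(1)] by (simp add: fun_eq_iff field_simps)
      then show False using nonprop[OF bc(2,1)] bc(3) by blast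
    qed
    ultimately show "functional \<delta> \<and> \<delta> \<noteq> 0" ..
  next
    fix x assume x: "\<And>\<delta>. \<delta> \<in> F \<Longrightarrow> \<delta> x \<noteq> 0"
    obtain q :: "complex poly" where q: "degree q \<le> d" "\<And>t. p (x + t *s y) = poly q t"
      using Sym_deg_line[OF p] by blast
    have inj: "inj_on (\<lambda>\<beta>. - \<beta> x / \<beta> y) S"
    proof (rule inj_onI, rule ccontr)
      fix \<beta> \<gamma> assume bc: "\<beta> \<in> S" "\<gamma> \<in> S" "- \<beta> x / \<beta> y = - \<gamma> x / \<gamma> y" "\<beta> \<noteq> \<gamma>"
      then have "(\<lambda>x. \<beta> y * \<gamma> x - \<gamma> y * \<beta> x) \<in> F" unfolding F_def by force
      from x[OF this] show False
        using bc(3) y[OF bc(1)] y[OF bc(2)] by (simp add: field_simps)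
    qed
    have "poly q (- \<beta> x / \<beta> y) = 0" if "\<beta> \<in> S" for \<beta>
      unfolding q(2)[symmetric]
      by (rule van[OF that])
        (use lin[OF that] y[OF that] in \<open>simp add: functional_add functional_scale del: scale_minus_left\<close>)
    then have sub: "(\<lambda>\<beta>. - \<beta> x / \<beta> y) ` S \<subseteq> {t. poly q t = 0}" by blast
    have "q = 0"
    proof (rule ccontr)
      assume "q \<noteq> 0"
      then have "card S \<le> degree q"
        using card_mono[OF poly_roots_finite sub] card_poly_roots_bound[of q] card_image[OF inj]
        by fastforce
      then show False using q(1) S(2) by simp
    qed
    then show "p x = 0" using q(2)[of 0] by simp
  qed
qed

text \<open>By the product rule, moving the argument by a multiple \<open>\<beta> x\<close> of a
  fixed vector changes \<open>p\<close> by a multiple of \<beta>. Subtraction truncates at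
  \<open>d = 0\<close>, so the vanishing of the quotient in that case is stated separately; it is
  needed for the class of degree 0.\<close>

lemma Sym_deg_divide_remainder:
  assumes "p \<in> Sym_deg d" and \<beta>: "functional \<beta>"
  shows "\<exists>q\<in>Sym_deg (d - 1). (d = 0 \<longrightarrow> q = 0) \<and> (\<forall>x. p x - p (x - \<beta> x *s e) = \<beta> x * q x)"
  using assms(1)
proof (induction rule: Sym_deg_induct)
  case (const c)
  show ?case using Sym_deg_zero by (intro bexI[of _ 0]) auto
next
  case (mult \<mu> d p)
  then obtain q where q: "q \<in> Sym_deg (d - 1)" "d = 0 \<longrightarrow> q = 0"
    "\<And>x. p x - p (x - \<beta> x *s e) = \<beta> x * q x" by blast
  have "endo (\<lambda>x. x - \<beta> x *s e)"
    using \<beta> by (auto simp: endo_iff functional_iff algebra_simps)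
  then have "p \<circ> (\<lambda>x. x - \<beta> x *s e) \<in> Sym_deg d" by (rule Sym_deg_comp[OF mult(2)])
  then have 1: "(\<lambda>_. \<mu> e) * (p \<circ> (\<lambda>x. x - \<beta> x *s e)) \<in> Sym_deg d" by (rule Sym_deg_smult)
  have 2: "\<mu> * q \<in> Sym_deg d"
  proof (cases d)
    case 0
    then show ?thesis using q(2) Sym_deg_zero by simp
  next
    case (Suc k)
    then show ?thesis using Sym_deg_mult[OF mult(1) q(1)] by simp
  qed
  have "(\<mu> * p) x - (\<mu> * p) (x - \<beta> x *s e)
      = \<beta> x * (\<mu> * q + (\<lambda>_. \<mu> e) * (p \<circ> (\<lambda>x. x - \<beta> x *s e))) x" for x
  proof -
    define x' where "x' = x - \<beta> x *s e"
    have "\<mu> x = \<mu> x' + \<beta> x * \<mu> e"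
      using mult(1) by (simp add: x'_def functional_diff functional_scale)
    moreover have "p x = p x' + \<beta> x * q x" using q(3)[of x] by (simp add: x'_def algebra_simps)
    ultimately show ?thesis
      by (simp add: x'_def[symmetric]) (simp add: algebra_simps)
  qed
  then show ?case
    using Sym_deg_add[OF 2 1] by (intro bexI[of _ "\<mu> * q + (\<lambda>_. \<mu> e) * (p \<circ> (\<lambda>x. x - \<beta> x *s e))"]) auto
next
  case (add d p p')
  then obtain q q' where q: "q \<in> Sym_deg (d - 1)" "d = 0 \<longrightarrow> q = 0"
    "\<And>x. p x - p (x - \<beta> x *s e) = \<beta> x * q x"
    "q' \<in> Sym_deg (d - 1)" "d = 0 \<longrightarrow> q' = 0"
    "\<And>x. p' x - p' (x - \<beta> x *s e) = \<beta> x * q' x" by blast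
  have "(p + p') x - (p + p') (x - \<beta> x *s e) = \<beta> x * (q + q') x" for x
    using q(3)[of x] q(6)[of x] by (simp add: algebra_simps)
  then show ?case
    using Sym_deg_add[OF q(1,4)] q(2,5) by (intro bexI[of _ "q + q'"]) auto
qed

lemma Sym_deg_divide:
  assumes p: "p \<in> Sym_deg d" and \<beta>: "functional \<beta>" "\<beta> \<noteq> 0"
    and van: "\<And>x. \<beta> x = 0 \<Longrightarrow> p x = 0"
  obtains q where "q \<in> Sym_deg (d - 1)" "d = 0 \<longrightarrow> q = 0" "p = \<beta> * q"
proof -
  obtain z where z: "\<beta> z \<noteq> 0" using \<beta>(2) by (auto simp: fun_eq_iff)
  \<comment> \<open>Normalised so that \<beta> takes the value 1 at \<open>e\<close>: then
    \<open>x - \<beta> x *s e\<close> lies in the hyperplane of \<beta>, and the subtracted term in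
    the remainder formula disappears.\<close>
  define e where "e = (1 / \<beta> z) *s z"
  have e: "\<beta> e = 1" using z functional_scale[OF \<beta>(1)] by (simp add: e_def)
  obtain q where q: "q \<in> Sym_deg (d - 1)" "d = 0 \<longrightarrow> q = 0"
    "\<And>x. p x - p (x - \<beta> x *s e) = \<beta> x * q x"
    using Sym_deg_divide_remainder[OF p \<beta>(1), of e] by blast
  have "p (x - \<beta> x *s e) = 0" for x
    by (rule van) (use e \<beta>(1) in \<open>simp add: functional_diff functional_scale\<close>)
  then have "p = \<beta> * q" using q(3) by (simp add: fun_eq_iff)
  then show thesis using that q by blast
qed

text \<open>Pointwise multiplication of functions has zero divisors, so \<beta> is cancelled by
  density: the two sides agree wherever \<beta> is nonzero.\<close>

lemma Sym_deg_mult_cancel: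
  assumes p: "p \<in> Sym_deg d" "q \<in> Sym_deg d" and \<beta>: "functional \<beta>" "\<beta> \<noteq> 0"
    and eq: "\<beta> * p = \<beta> * q"
  shows "p = q"
proof -
  have "p - q = 0"
  proof (rule Sym_deg_zero_off_hyperplanes[OF Sym_deg_diff[OF p], of "{\<beta>}"])
    fix x assume "\<And>\<gamma>. \<gamma> \<in> {\<beta>} \<Longrightarrow> \<gamma> x \<noteq> 0"
    then show "(p - q) x = 0" using fun_cong[OF eq, of x] by simp
  qed (use \<beta> in auto)
  then show ?thesis by simp
qed

text \<open>Cancellation inside the hyperplane of \<beta>. The vector \<open>y\<close> is a
  direction within it along which \<alpha> varies, so on the line through \<open>x\<close> the
  factor \<alpha> is zero at one point only.\<close>

lemma Sym_deg_vanish_cancel: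
  assumes p: "p \<in> Sym_deg d" and \<alpha>: "functional \<alpha>" and \<beta>: "functional \<beta>"
    and y: "\<beta> y = 0" "\<alpha> y \<noteq> 0"
    and van: "\<And>x. \<beta> x = 0 \<Longrightarrow> \<alpha> x * p x = 0" and x: "\<beta> x = 0"
  shows "p x = 0"
proof -
  obtain q :: "complex poly" where q: "\<And>t. p (x + t *s y) = poly q t"
    using Sym_deg_line[OF p] by blast
  have "poly q t = 0" if "t \<noteq> - \<alpha> x / \<alpha> y" for t
  proof -
    have "\<beta> (x + t *s y) = 0"
      using \<beta> x y by (simp add: functional_add functional_scale)
    moreover have "\<alpha> (x + t *s y) \<noteq> 0"
    proof
      assume "\<alpha> (x + t *s y) = 0"
      then have "t = - \<alpha> x / \<alpha> y"
        using \<alpha> y by (simp add: functional_add functional_scale field_simps add_eq_0_iff)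
      then show False using that by simp
    qed
    ultimately show ?thesis using van q by (metis mult_eq_0_iff)
  qed
  then have "- {- \<alpha> x / \<alpha> y} \<subseteq> {t. poly q t = 0}" by blast
  moreover have "infinite (- {- \<alpha> x / \<alpha> y})"
    using infinite_UNIV_char_0[where 'a = complex] by (simp add: Compl_eq_Diff_UNIV)
  ultimately have "q = 0"
    using poly_roots_finite finite_subset by blast
  then show ?thesis using q[of 0] by simp
qed

subsection \<open>Schubert classes and left divided differences\<close>

text \<open>The Goresky-Kottwitz-MacPherson congruences in left-handed, pointwise form. Ranging over
  all roots costs nothing, since opposite roots share their reflection and their hyperplane.\<close>

definition gkm :: "(('t \<Rightarrow> 't) \<Rightarrow> 't \<Rightarrow> complex) \<Rightarrow> bool"
  where "gkm f \<longleftrightarrow> (\<forall>v\<in>weyl. \<forall>\<gamma>\<in>R. \<forall>x. \<gamma> x = 0 \<longrightarrow> f (srefl \<gamma> \<circ> v) x = f v x)"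

lemma gkmD: "gkm f \<Longrightarrow> v \<in> weyl \<Longrightarrow> \<gamma> \<in> R \<Longrightarrow> \<gamma> x = 0 \<Longrightarrow> f (srefl \<gamma> \<circ> v) x = f v x"
  by (simp add: gkm_def)

lemma root_ne_0: "\<beta> \<in> R \<Longrightarrow> \<beta> \<noteq> 0"
  using root_nonzero by blast

lemma srefl_conj_inv:
  assumes "w \<in> weyl" "\<beta> \<in> R"
  shows "w \<circ> srefl \<beta> = srefl (\<beta> \<circ> inv w) \<circ> w"
proof -
  have "\<beta> \<circ> inv w \<circ> w = \<beta>"
    using assms by (simp add: fun_eq_iff)
  then show ?thesis
    using srefl_conj[OF assms(1) root_comp_weyl[OF weyl_inv[OF assms(1)] assms(2)]] by simp
qed

text \<open>For \<open>\<gamma> = act w \<beta>\<close> the right factor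
  \<open>srefl \<beta>\<close> of \<open>w\<close> is the left factor \<open>srefl \<gamma>\<close>.
  Homogeneity of the values lets \<open>Sym_deg_divide\<close> turn vanishing on the hyperplane back
  into a polynomial quotient.\<close>

lemma H_iff_gkm:
  assumes "f \<in> extensional weyl" "\<And>v. v \<in> weyl \<Longrightarrow> f v \<in> Sym_deg d"
  shows "f \<in> H \<longleftrightarrow> gkm f"
proof
  assume H: "f \<in> H"
  have pos: "f (srefl \<gamma> \<circ> v) x = f v x" if "v \<in> weyl" "\<gamma> \<in> R" "\<gamma> \<circ> v \<in> pos_roots" "\<gamma> x = 0" for v \<gamma> x
  proof -
    obtain q where "f (v \<circ> srefl (\<gamma> \<circ> v)) - f v = act v (\<gamma> \<circ> v) * q"
      using H \<open>v \<in> weyl\<close> \<open>\<gamma> \<circ> v \<in> pos_roots\<close> unfolding H_def by blast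
    from fun_cong[OF this, of x] show ?thesis
      using that by (simp add: srefl_conj act_def)
  qed
  show "gkm f"
    unfolding gkm_def
  proof (intro ballI allI impI)
    fix v \<gamma> x assume v: "v \<in> weyl" "\<gamma> \<in> R" "\<gamma> x = 0"
    have "- \<gamma> \<circ> v = - (\<gamma> \<circ> v)" by (simp add: fun_eq_iff)
    moreover have "\<gamma> \<circ> v \<in> pos_roots \<or> - (\<gamma> \<circ> v) \<in> pos_roots"
      using pos_or_neg root_comp_weyl v by blast
    ultimately show "f (srefl \<gamma> \<circ> v) x = f v x"
      using pos[of v \<gamma> x] pos[of v "- \<gamma>" x] v by (auto simp: srefl_minus root_minus)
  qed
next
  assume g: "gkm f"
  have "\<exists>q\<in>Sym. f (w \<circ> srefl \<beta>) - f w = act w \<beta> * q" if w: "w \<in> weyl" and \<beta>: "\<beta> \<in> pos_roots" for w \<beta>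
  proof -
    define \<gamma> where "\<gamma> = \<beta> \<circ> inv w"
    have \<gamma>: "\<gamma> \<in> R" unfolding \<gamma>_def using root_comp_weyl[OF weyl_inv[OF w] pos_root[OF \<beta>]] .
    have "f (srefl \<gamma> \<circ> w) - f w \<in> Sym_deg d"
      using assms(2) w weyl.step[OF \<gamma> w] by (intro Sym_deg_diff) auto
    moreover have "(f (srefl \<gamma> \<circ> w) - f w) x = 0" if "\<gamma> x = 0" for x
      using gkmD[OF g w \<gamma> that] by simp
    ultimately obtain q where "q \<in> Sym_deg (d - 1)" "f (srefl \<gamma> \<circ> w) - f w = \<gamma> * q"
      using Sym_deg_divide[OF _ root_linear[OF \<gamma>] root_ne_0[OF \<gamma>]] by metis
    then show ?thesis
      unfolding act_def \<gamma>_def srefl_conj_inv[OF w pos_root[OF \<beta>]] using Sym_deg_Sym by blast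
  qed
  then show "f \<in> H"
    using assms Sym_deg_Sym[OF assms(2)] by (simp add: H_def PiE_def)
qed

text \<open>The action of \<open>inv u\<close> on \<beta> is \<open>\<beta> \<circ> u\<close>, so
  the normalising product of a Schubert class runs over the inversions, whose number is the
  degree.\<close>

lemma inversions_act:
  assumes "u \<in> weyl"
  shows "{\<beta> \<in> pos_roots. act (inv u) \<beta> \<in> uminus ` pos_roots} = inversions u"
proof -
  have "\<beta> \<in> uminus ` pos_roots \<longleftrightarrow> - \<beta> \<in> pos_roots" for \<beta>
    by (metis add.inverse_inverse image_iff)
  then show ?thesis
    by (simp add: inversions_def act_def weyl_inv_inv[OF assms])
qed

lemma is_schubert_iff:
  assumes "u \<in> weyl"
  shows "is_schubert u f \<longleftrightarrow> f \<in> extensional weyl \<and> gkm f \<and> (\<forall>v\<in>weyl. f v \<in> Sym_deg (len u)) \<and>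
    (\<forall>v\<in>weyl. f v \<noteq> 0 \<longrightarrow> bruhat u v) \<and> f u = (\<Prod>\<beta>\<in>inversions u. \<beta>)"
proof -
  have "f \<in> H \<Longrightarrow> f \<in> extensional weyl" by (simp add: H_def PiE_def)
  then show ?thesis
    unfolding is_schubert_def inversions_act[OF assms] using H_iff_gkm[of f "len u"] by blast
qed

text \<open>Conjugating a reflection by \<open>u\<close> gives a reflection, so left and right steps
  from \<open>u\<close> reach the same elements. The left form interacts directly with left
  multiplication by a simple reflection.\<close>

lemma bruhat_left:
  "bruhat = (\<lambda>u v. u \<in> weyl \<and> (\<exists>\<gamma>\<in>pos_roots. v = srefl \<gamma> \<circ> u \<and> len u < len v))\<^sup>*\<^sup>*"
proof -
  have "(\<exists>\<beta>\<in>pos_roots. v = u \<circ> srefl \<beta> \<and> len u < len v)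
      \<longleftrightarrow> (\<exists>\<gamma>\<in>pos_roots. v = srefl \<gamma> \<circ> u \<and> len u < len v)" if u: "u \<in> weyl" for u v
  proof
    assume "\<exists>\<beta>\<in>pos_roots. v = u \<circ> srefl \<beta> \<and> len u < len v"
    then obtain \<beta> where \<beta>: "\<beta> \<in> pos_roots" "v = u \<circ> srefl \<beta>" "len u < len v" by blast
    have r: "\<beta> \<circ> inv u \<in> R" using root_comp_weyl[OF weyl_inv[OF u] pos_root[OF \<beta>(1)]] .
    have "v = srefl (\<beta> \<circ> inv u) \<circ> u" using \<beta>(2) srefl_conj_inv[OF u pos_root[OF \<beta>(1)]] by simp
    then show "\<exists>\<gamma>\<in>pos_roots. v = srefl \<gamma> \<circ> u \<and> len u < len v"
      using pos_or_neg[OF r] srefl_minus[OF r] \<beta>(3) by metis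
  next
    assume "\<exists>\<gamma>\<in>pos_roots. v = srefl \<gamma> \<circ> u \<and> len u < len v"
    then obtain \<gamma> where \<gamma>: "\<gamma> \<in> pos_roots" "v = srefl \<gamma> \<circ> u" "len u < len v" by blast
    have r: "\<gamma> \<circ> u \<in> R" using root_comp_weyl[OF u pos_root[OF \<gamma>(1)]] .
    have "v = u \<circ> srefl (\<gamma> \<circ> u)" using \<gamma>(2) srefl_conj[OF u pos_root[OF \<gamma>(1)]] by simp
    then show "\<exists>\<beta>\<in>pos_roots. v = u \<circ> srefl \<beta> \<and> len u < len v"
      using pos_or_neg[OF r] srefl_minus[OF r] \<gamma>(3) by metis
  qed
  then show ?thesis
    unfolding bruhat_def by (intro arg_cong[of _ _ rtranclp] ext) blast
qed

lemma bruhat_refl: "bruhat u u"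
  by (simp add: bruhat_def)

lemma bruhat_trans: "bruhat u v \<Longrightarrow> bruhat v w \<Longrightarrow> bruhat u w"
  unfolding bruhat_def by (rule rtranclp_trans)

lemma bruhat_srefl: "u \<in> weyl \<Longrightarrow> \<gamma> \<in> pos_roots \<Longrightarrow> len u < len (srefl \<gamma> \<circ> u) \<Longrightarrow> bruhat u (srefl \<gamma> \<circ> u)"
  unfolding bruhat_left by (rule r_into_rtranclp) blast

lemma bruhat_len: "bruhat u v \<Longrightarrow> u = v \<or> len u < len v"
  unfolding bruhat_left
proof (induction rule: rtranclp_induct)
  case (step y z)
  then show ?case by (metis less_trans)
qed simp

text \<open>Left multiplication by \<open>srefl \<alpha>\<close> carries a Bruhat step along
  \<gamma> \<noteq> \<alpha> to a step along \<open>\<gamma> \<circ> srefl \<alpha>\<close>, still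
  positive, with the same image root \<open>\<gamma> \<circ> x\<close>. A step along \<alpha> is
  merely reversed; there the second alternative takes over, because
  \<open>srefl \<alpha> \<circ> z\<close> is the preceding element of the chain.\<close>

lemma bruhat_lifting:
  assumes "bruhat u y" and \<alpha>: "\<alpha> \<in> base"
  shows "bruhat (srefl \<alpha> \<circ> u) (srefl \<alpha> \<circ> y) \<or> bruhat u (srefl \<alpha> \<circ> y)"
proof -
  have edge: "bruhat (srefl \<alpha> \<circ> x) (srefl \<alpha> \<circ> z) \<or> z = srefl \<alpha> \<circ> x"
    if x: "x \<in> weyl" and \<gamma>: "\<gamma> \<in> pos_roots" "z = srefl \<gamma> \<circ> x" "len x < len z" for x z \<gamma>
  proof (cases "\<gamma> = \<alpha>")
    case False
    have p: "\<gamma> \<circ> srefl \<alpha> \<in> pos_roots" using simple_reflection_pos[OF \<alpha> \<gamma>(1) False] .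
    have sx: "srefl \<alpha> \<circ> x \<in> weyl" using weyl.step[OF base_root[OF \<alpha>] x] .
    have eq: "(\<gamma> \<circ> srefl \<alpha>) \<circ> (srefl \<alpha> \<circ> x) = \<gamma> \<circ> x"
      using srefl_srefl[OF base_root[OF \<alpha>]] by (simp add: fun_eq_iff)
    have "\<gamma> \<circ> x \<in> pos_roots"
      using pos_or_neg[OF root_comp_weyl[OF x pos_root[OF \<gamma>(1)]]] len_srefl_less[OF \<gamma>(1) x] \<gamma> by auto
    then have "len (srefl \<alpha> \<circ> x) < len (srefl (\<gamma> \<circ> srefl \<alpha>) \<circ> (srefl \<alpha> \<circ> x))"
      by (intro len_srefl_greater[OF p sx]) (simp only: eq)
    moreover have "srefl (\<gamma> \<circ> srefl \<alpha>) \<circ> (srefl \<alpha> \<circ> x) = srefl \<alpha> \<circ> z"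
      using srefl_comp_srefl[OF base_root[OF \<alpha>] pos_root[OF \<gamma>(1)]] srefl_srefl[OF base_root[OF \<alpha>]] \<gamma>(2)
      by (simp add: fun_eq_iff)
    ultimately show ?thesis
      using bruhat_srefl[OF sx p] by simp
  qed (use \<gamma> in simp)
  from assms(1)[unfolded bruhat_left] show ?thesis
  proof (induction rule: rtranclp_induct)
    case base
    then show ?case using bruhat_refl by blast
  next
    case (step y z)
    then obtain \<gamma> where "y \<in> weyl" "\<gamma> \<in> pos_roots" "z = srefl \<gamma> \<circ> y" "len y < len z" by blast
    from edge[OF this] show "bruhat (srefl \<alpha> \<circ> u) (srefl \<alpha> \<circ> z) \<or> bruhat u (srefl \<alpha> \<circ> z)"
    proof
      assume "bruhat (srefl \<alpha> \<circ> y) (srefl \<alpha> \<circ> z)"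
      then show ?thesis using step.IH bruhat_trans by blast
    next
      assume "z = srefl \<alpha> \<circ> y"
      then have "srefl \<alpha> \<circ> z = y" using srefl_cancel[OF base_root[OF \<alpha>]] by simp
      moreover have "bruhat u y" using step.hyps(1) unfolding bruhat_left .
      ultimately show ?thesis by simp
    qed
  qed
qed

text \<open>A nonzero value at \<open>v\<close> of minimal length vanishes on the \<open>\<ell>(v)\<close> hyperplanes of the inversions
  of \<open>v\<close>, so its degree is at least \<open>\<ell>(v)\<close>.\<close>

lemma gkm_eq_zero:
  assumes g: "gkm f" and deg: "\<And>v. v \<in> weyl \<Longrightarrow> f v \<in> Sym_deg d"
    and supp: "\<And>v. v \<in> weyl \<Longrightarrow> f v \<noteq> 0 \<Longrightarrow> d < len v" and v: "v \<in> weyl"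
  shows "f v = 0"
  using v
proof (induction "len v" arbitrary: v rule: less_induct)
  case less
  show ?case
  proof (rule ccontr)
    assume nz: "f v \<noteq> 0"
    have "f v = 0"
    proof (rule Sym_deg_zero_of_hyperplanes[OF deg[OF less.prems] finite_inversions[of v]])
      show "d < card (inversions v)"
        using supp[OF less.prems nz] len_eq_card_inversions[OF less.prems] by simp
    next
      fix \<beta> assume "\<beta> \<in> inversions v"
      then have "\<beta> \<in> R" using pos_root by (simp add: inversions_def)
      then show "functional \<beta> \<and> \<beta> \<noteq> 0" using root_linear root_ne_0 by simp
    next
      fix \<beta> \<gamma> k assume "\<beta> \<in> inversions v" "\<gamma> \<in> inversions v" and eq: "\<beta> = (\<lambda>x. k * \<gamma> x)"
      then have p: "\<beta> \<in> pos_roots" "\<gamma> \<in> pos_roots" by (simp_all add: inversions_def)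
      then have "k = 1 \<or> k = - 1"
        using reduced[OF pos_root[OF p(2)], of k] pos_root[OF p(1)] eq by simp
      then show "\<beta> = \<gamma>"
      proof
        assume "k = - 1"
        then have "- \<gamma> = \<beta>" using eq by (simp add: fun_eq_iff)
        then show ?thesis using not_pos_and_neg p by metis
      qed (use eq in simp)
    next
      fix \<beta> x assume "\<beta> \<in> inversions v" "\<beta> x = 0"
      then have \<beta>: "\<beta> \<in> pos_roots" "- (\<beta> \<circ> v) \<in> pos_roots" by (simp_all add: inversions_def)
      have "f (srefl \<beta> \<circ> v) = 0"
        using less.hyps[OF len_srefl_less[OF \<beta>(1) less.prems \<beta>(2)]] weyl.step[OF pos_root[OF \<beta>(1)] less.prems]
        by blast
      then show "f v x = 0"
        using gkmD[OF g less.prems pos_root[OF \<beta>(1)] \<open>\<beta> x = 0\<close>] by simp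
    qed
    with nz show False by simp
  qed
qed

lemma functional_proportional:
  assumes "functional \<alpha>" "functional \<gamma>" "\<gamma> \<noteq> 0" "\<And>y. \<gamma> y = 0 \<Longrightarrow> \<alpha> y = 0"
  obtains k where "\<alpha> = (\<lambda>x. k * \<gamma> x)"
proof -
  obtain z where z: "\<gamma> z \<noteq> 0" using assms(3) by (auto simp: fun_eq_iff)
  have "\<alpha> x = (\<alpha> z / \<gamma> z) * \<gamma> x" for x
  proof -
    have "\<gamma> (x - (\<gamma> x / \<gamma> z) *s z) = 0"
      using z assms(2) by (simp add: functional_diff functional_scale)
    then have "\<alpha> (x - (\<gamma> x / \<gamma> z) *s z) = 0" by (rule assms(4))
    then show ?thesis
      using z assms(1) by (simp add: functional_diff functional_scale field_simps)
  qed
  then show thesis using that by blast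
qed

text \<open>The numerator is divisible because \<open>srefl \<alpha>\<close> fixes the hyperplane of
  \<alpha> and the congruence for \<alpha> holds there. The congruence of the quotient along
  \<gamma> comes from those of \<open>f\<close> along \<gamma> and
  \<open>\<gamma> \<circ> srefl \<alpha>\<close>, followed by cancelling \<alpha>.\<close>

lemma left_divided_difference:
  assumes \<alpha>: "\<alpha> \<in> base" and g: "gkm f" and deg: "\<And>v. v \<in> weyl \<Longrightarrow> f v \<in> Sym_deg d"
  obtains \<delta> where "\<delta> \<in> extensional weyl" "gkm \<delta>" "\<And>v. v \<in> weyl \<Longrightarrow> \<delta> v \<in> Sym_deg (d - 1)"
    "\<And>v. v \<in> weyl \<Longrightarrow> d = 0 \<Longrightarrow> \<delta> v = 0"
    "\<And>v. v \<in> weyl \<Longrightarrow> f v - (f (srefl \<alpha> \<circ> v) \<circ> srefl \<alpha>) = \<alpha> * \<delta> v"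
proof -
  have r: "\<alpha> \<in> R" using base_root[OF \<alpha>] .
  have fixed: "srefl \<alpha> x = x" if "\<alpha> x = 0" for x using that by (simp add: srefl_def)
  have W: "srefl \<alpha> \<circ> v \<in> weyl" if "v \<in> weyl" for v using weyl.step[OF r that] .
  have "\<exists>q. q \<in> Sym_deg (d - 1) \<and> (d = 0 \<longrightarrow> q = 0) \<and> f v - (f (srefl \<alpha> \<circ> v) \<circ> srefl \<alpha>) = \<alpha> * q"
    if v: "v \<in> weyl" for v
  proof -
    have "f v - (f (srefl \<alpha> \<circ> v) \<circ> srefl \<alpha>) \<in> Sym_deg d"
      using deg[OF v] deg[OF W[OF v]] srefl_endo[OF r] by (intro Sym_deg_diff Sym_deg_comp)
    moreover have "(f v - (f (srefl \<alpha> \<circ> v) \<circ> srefl \<alpha>)) x = 0" if "\<alpha> x = 0" for x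
      using gkmD[OF g v r that] fixed[OF that] by simp
    ultimately obtain q where "q \<in> Sym_deg (d - 1)" "d = 0 \<longrightarrow> q = 0"
      "f v - (f (srefl \<alpha> \<circ> v) \<circ> srefl \<alpha>) = \<alpha> * q"
      by (rule Sym_deg_divide[OF _ root_linear[OF r] root_ne_0[OF r]]) blast
    then show ?thesis by blast
  qed
  then have "\<forall>v\<in>weyl. \<exists>q. q \<in> Sym_deg (d - 1) \<and> (d = 0 \<longrightarrow> q = 0) \<and> f v - (f (srefl \<alpha> \<circ> v) \<circ> srefl \<alpha>) = \<alpha> * q"
    by blast
  from bchoice[OF this] obtain h where h: "\<forall>v\<in>weyl. h v \<in> Sym_deg (d - 1) \<and> (d = 0 \<longrightarrow> h v = 0) \<and>
      f v - (f (srefl \<alpha> \<circ> v) \<circ> srefl \<alpha>) = \<alpha> * h v" ..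
  define \<delta> where "\<delta> = restrict h weyl"
  have \<delta>: "\<delta> v \<in> Sym_deg (d - 1)" "d = 0 \<Longrightarrow> \<delta> v = 0"
    and eq: "f v - (f (srefl \<alpha> \<circ> v) \<circ> srefl \<alpha>) = \<alpha> * \<delta> v" if "v \<in> weyl" for v
    using h that by (simp_all add: \<delta>_def)
  have eqx: "f v x - f (srefl \<alpha> \<circ> v) (srefl \<alpha> x) = \<alpha> x * \<delta> v x" if "v \<in> weyl" for v x
    using fun_cong[OF eq[OF that], of x] by simp
  \<comment> \<open>Replacing \<open>v\<close> by \<open>srefl \<alpha> \<circ> v\<close> negates
    the numerator composed with the reflection, and \<alpha> also changes sign under it; the two
    signs cancel in the quotient.\<close>
  have swap: "\<delta> (srefl \<alpha> \<circ> v) = \<delta> v \<circ> srefl \<alpha>" if v: "v \<in> weyl" for v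
  proof (rule Sym_deg_mult_cancel[OF \<delta>(1)[OF W[OF v]] Sym_deg_comp[OF \<delta>(1)[OF v] srefl_endo[OF r]]
        root_linear[OF r] root_ne_0[OF r]])
    show "\<alpha> * \<delta> (srefl \<alpha> \<circ> v) = \<alpha> * (\<delta> v \<circ> srefl \<alpha>)"
    proof
      fix x
      have "\<alpha> (srefl \<alpha> x) = - \<alpha> x" using fun_cong[OF root_comp_self[OF r], of x] by simp
      then have "f v (srefl \<alpha> x) - f (srefl \<alpha> \<circ> v) x = - \<alpha> x * \<delta> v (srefl \<alpha> x)"
        using eqx[OF v, of "srefl \<alpha> x"] srefl_srefl[OF r] by simp
      then have "\<alpha> x * \<delta> v (srefl \<alpha> x) = f (srefl \<alpha> \<circ> v) x - f v (srefl \<alpha> x)"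
        by (simp add: algebra_simps)
      also have "\<dots> = \<alpha> x * \<delta> (srefl \<alpha> \<circ> v) x"
        using eqx[OF W[OF v], of x] by (simp only: srefl_cancel[OF r])
      finally show "(\<alpha> * \<delta> (srefl \<alpha> \<circ> v)) x = (\<alpha> * (\<delta> v \<circ> srefl \<alpha>)) x"
        by auto
    qed
  qed
  have "gkm \<delta>"
    unfolding gkm_def
  proof (intro ballI allI impI)
    fix v \<gamma> x assume v: "v \<in> weyl" and \<gamma>: "\<gamma> \<in> R" and x: "\<gamma> x = 0"
    show "\<delta> (srefl \<gamma> \<circ> v) x = \<delta> v x"
    \<comment> \<open>On the hyperplane of \<gamma> the factor \<alpha> can be cancelled only if it
      does not vanish identically there. Otherwise \<gamma> is \<alpha> or its negative, and
      \<open>swap\<close> gives the congruence because the reflection fixes the hyperplane.\<close>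
    proof (cases "\<exists>y. \<gamma> y = 0 \<and> \<alpha> y \<noteq> 0")
      case True
      then obtain y where y: "\<gamma> y = 0" "\<alpha> y \<noteq> 0" by blast
      have gv: "srefl \<gamma> \<circ> v \<in> weyl" using weyl.step[OF \<gamma> v] .
      have "(\<delta> (srefl \<gamma> \<circ> v) - \<delta> v) x = 0"
      proof (rule Sym_deg_vanish_cancel[OF Sym_deg_diff[OF \<delta>(1)[OF gv] \<delta>(1)[OF v]] root_linear[OF r] root_linear[OF \<gamma>] y _ x])
        fix z assume z: "\<gamma> z = 0"
        have "srefl \<alpha> \<circ> (srefl \<gamma> \<circ> v) = srefl (\<gamma> \<circ> srefl \<alpha>) \<circ> (srefl \<alpha> \<circ> v)"
          using srefl_comp_srefl[OF r \<gamma>] srefl_srefl[OF r] by (simp add: fun_eq_iff)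
        moreover have "(\<gamma> \<circ> srefl \<alpha>) (srefl \<alpha> z) = 0" using srefl_srefl[OF r] z by simp
        ultimately have "f (srefl \<alpha> \<circ> (srefl \<gamma> \<circ> v)) (srefl \<alpha> z) = f (srefl \<alpha> \<circ> v) (srefl \<alpha> z)"
          using gkmD[OF g W[OF v] root_comp_srefl[OF r \<gamma>]] by metis
        moreover have "f (srefl \<gamma> \<circ> v) z = f v z" using gkmD[OF g v \<gamma> z] .
        ultimately show "\<alpha> z * (\<delta> (srefl \<gamma> \<circ> v) - \<delta> v) z = 0"
          using eqx[OF gv, of z] eqx[OF v, of z] by (auto simp: right_diff_distrib)
      qed
      then show ?thesis by simp
    next
      case False
      then obtain k where k: "\<alpha> = (\<lambda>x. k * \<gamma> x)"
        using functional_proportional[OF root_linear[OF r] root_linear[OF \<gamma>] root_ne_0[OF \<gamma>]] by blast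
      then have "k = 1 \<or> k = - 1" using reduced[OF \<gamma>, of k] r by simp
      then have "\<gamma> = \<alpha> \<or> \<gamma> = - \<alpha>" using k by (auto simp: fun_eq_iff)
      then have "srefl \<gamma> = srefl \<alpha>" using srefl_minus[OF r] by auto
      moreover have "\<alpha> x = 0" using k x by simp
      ultimately show ?thesis using swap[OF v] fixed by simp
    qed
  qed
  then show thesis
    using that[of \<delta>] \<delta> eq by (simp add: \<delta>_def)
qed

section \<open>Uniqueness and existence of Schubert classes\<close>

lemma is_schubert_unique:
  assumes u: "u \<in> weyl" and f: "is_schubert u f" and f': "is_schubert u f'"
  shows "f = f'"
proof (rule extensionalityI[of _ weyl])
  note F = f[unfolded is_schubert_iff[OF u]] and F' = f'[unfolded is_schubert_iff[OF u]]
  show "f \<in> extensional weyl" "f' \<in> extensional weyl" using F F' by simp_all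
  fix v assume v: "v \<in> weyl"
  have "(\<lambda>v. f v - f' v) v = 0"
  proof (rule gkm_eq_zero[OF _ _ _ v])
    show "gkm (\<lambda>v. f v - f' v)" using F F' by (simp add: gkm_def)
    fix v assume v: "v \<in> weyl"
    show "f v - f' v \<in> Sym_deg (len u)" using F F' v Sym_deg_diff by blast
    assume nz: "f v - f' v \<noteq> 0"
    then have "f v \<noteq> 0 \<or> f' v \<noteq> 0" by auto
    then have "bruhat u v" using F F' v by blast
    moreover have "u \<noteq> v" using F F' nz by auto
    ultimately show "len u < len v" using bruhat_len by blast
  qed
  then show "f v = f' v" by simp
qed

text \<open>The quotient can be nonzero at \<open>v\<close> only if \<open>f\<close> is nonzero at
  \<open>v\<close> or at \<open>srefl \<alpha> \<circ> v\<close>; in the second case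
  \<open>bruhat_lifting\<close> brings the support back above \<open>u\<close>. Degree and
  congruences come from the divided difference, so only the value at \<open>u\<close> has to be
  computed.\<close>

lemma is_schubert_descend:
  assumes \<alpha>: "\<alpha> \<in> base" and u: "u \<in> weyl" and pos: "\<alpha> \<circ> u \<in> pos_roots"
    and f: "is_schubert (srefl \<alpha> \<circ> u) f"
  obtains \<delta> where "is_schubert u \<delta>" "\<And>v. v \<in> weyl \<Longrightarrow> f v - (f (srefl \<alpha> \<circ> v) \<circ> srefl \<alpha>) = \<alpha> * \<delta> v"
proof -
  have r: "\<alpha> \<in> R" using base_root[OF \<alpha>] .
  have W: "srefl \<alpha> \<circ> v \<in> weyl" if "v \<in> weyl" for v using weyl.step[OF r that] .
  note F = f[unfolded is_schubert_iff[OF W[OF u]]]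
  have len: "len (srefl \<alpha> \<circ> u) = Suc (len u)" using len_srefl_Suc[OF \<alpha> u pos] .
  have gf: "gkm f" and degf: "\<And>v. v \<in> weyl \<Longrightarrow> f v \<in> Sym_deg (Suc (len u))"
    and suppf: "\<And>v. v \<in> weyl \<Longrightarrow> f v \<noteq> 0 \<Longrightarrow> bruhat (srefl \<alpha> \<circ> u) v"
    using F len by auto
  obtain \<delta> where \<delta>: "\<delta> \<in> extensional weyl" "gkm \<delta>" "\<And>v. v \<in> weyl \<Longrightarrow> \<delta> v \<in> Sym_deg (Suc (len u) - 1)"
    and eq: "\<And>v. v \<in> weyl \<Longrightarrow> f v - (f (srefl \<alpha> \<circ> v) \<circ> srefl \<alpha>) = \<alpha> * \<delta> v"
    using left_divided_difference[OF \<alpha> gf degf] by metis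
  have up: "bruhat u (srefl \<alpha> \<circ> u)"
    using bruhat_srefl[OF u base_pos[OF \<alpha>]] len by simp
  have supp: "bruhat u v" if v: "v \<in> weyl" and nz: "\<delta> v \<noteq> 0" for v
  proof -
    have "f v \<noteq> 0 \<or> f (srefl \<alpha> \<circ> v) \<noteq> 0"
    proof (rule ccontr)
      assume "\<not> ?thesis"
      then have "\<alpha> * \<delta> v = \<alpha> * 0" using eq[OF v] by (auto simp: fun_eq_iff)
      from Sym_deg_mult_cancel[OF \<delta>(3)[OF v] Sym_deg_zero root_linear[OF r] root_ne_0[OF r] this]
      show False using nz by simp
    qed
    then consider "bruhat (srefl \<alpha> \<circ> u) v" | "bruhat (srefl \<alpha> \<circ> u) (srefl \<alpha> \<circ> v)"
      using suppf v W by blast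
    then show ?thesis
    proof cases
      case 1
      then show ?thesis using up bruhat_trans by blast
    next
      case 2
      from bruhat_lifting[OF this \<alpha>] show ?thesis
        using up bruhat_trans by (auto simp: srefl_cancel[OF r])
    qed
  qed
  \<comment> \<open>As \<open>u\<close> is shorter than \<open>srefl \<alpha> \<circ> u\<close>,
    only the reflected term contributes at \<open>u\<close>. Composing with the reflection restores
    the inversions of \<open>u\<close> and negates the extra factor \<alpha>, cancelling the minus
    sign of the difference.\<close>
  have "f u = 0"
  proof (rule ccontr)
    assume "f u \<noteq> 0"
    from bruhat_len[OF suppf[OF u this]] len show False by auto
  qed
  moreover have "f (srefl \<alpha> \<circ> u) = \<alpha> * (\<Prod>\<beta>\<in>inversions u. \<beta> \<circ> srefl \<alpha>)"
  proof -
    have "f (srefl \<alpha> \<circ> u) = (\<Prod>\<beta>\<in>inversions (srefl \<alpha> \<circ> u). \<beta>)" using F by blast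
    also have "\<dots> = \<alpha> * (\<Prod>\<beta>\<in>(\<lambda>\<beta>. \<beta> \<circ> srefl \<alpha>) ` inversions u. \<beta>)"
      unfolding inversions_srefl(1)[OF \<alpha> u pos]
      using inversions_srefl(2)[OF \<alpha> u pos] finite_inversions[of u] by (intro prod.insert) auto
    also have "(\<Prod>\<beta>\<in>(\<lambda>\<beta>. \<beta> \<circ> srefl \<alpha>) ` inversions u. \<beta>) = (\<Prod>\<beta>\<in>inversions u. \<beta> \<circ> srefl \<alpha>)"
      using prod.reindex[OF inversions_srefl(3)[OF \<alpha> u pos], of "\<lambda>\<beta>. \<beta>"] by (simp add: o_def)
    finally show ?thesis .
  qed
  moreover have "(\<alpha> * (\<Prod>\<beta>\<in>inversions u. \<beta> \<circ> srefl \<alpha>)) \<circ> srefl \<alpha> = - (\<alpha> * (\<Prod>\<beta>\<in>inversions u. \<beta>))"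
  proof -
    have "(\<Prod>\<beta>\<in>A. \<beta> \<circ> srefl \<alpha>) \<circ> srefl \<alpha> = (\<Prod>\<beta>\<in>A. \<beta>)" for A :: "('t \<Rightarrow> complex) set"
      by (induction A rule: infinite_finite_induct) (auto simp: fun_eq_iff srefl_srefl[OF r])
    then show ?thesis
      using root_comp_self[OF r] by (simp add: fun_eq_iff)
  qed
  ultimately have "\<alpha> * \<delta> u = \<alpha> * (\<Prod>\<beta>\<in>inversions u. \<beta>)"
    using eq[OF u] by simp
  moreover have "(\<Prod>\<beta>\<in>inversions u. \<beta>) \<in> Sym_deg (Suc (len u) - 1)"
    using Sym_deg_prod[OF finite_inversions[of u]] len_eq_card_inversions[OF u] pos_root root_linear
    by (simp add: inversions_def)
  ultimately have "\<delta> u = (\<Prod>\<beta>\<in>inversions u. \<beta>)"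
    using Sym_deg_mult_cancel[OF \<delta>(3)[OF u] _ root_linear[OF r] root_ne_0[OF r]] by blast
  then have "is_schubert u \<delta>"
    unfolding is_schubert_iff[OF u] using \<delta> supp by simp
  then show thesis using eq that by blast
qed

text \<open>Every positive root is a nonnegative combination of simple ones, so its image is again a
  nonpositive combination. Hence an element without left ascents inverts everything.\<close>

lemma inversions_all:
  assumes u: "u \<in> weyl" and all: "\<And>\<alpha>. \<alpha> \<in> base \<Longrightarrow> - (\<alpha> \<circ> u) \<in> pos_roots"
  shows "inversions u = pos_roots"
proof -
  have "- (\<beta> \<circ> u) \<in> pos_roots" if \<beta>: "\<beta> \<in> pos_roots" for \<beta>
  proof -
    obtain m :: "('t \<Rightarrow> complex) \<Rightarrow> nat" where m: "\<beta> = (\<lambda>x. \<Sum>\<alpha>\<in>base. of_nat (m \<alpha>) * \<alpha> x)"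
      using \<beta> unfolding pos_roots_def by blast
    have "\<forall>\<alpha>\<in>base. \<exists>n :: ('t \<Rightarrow> complex) \<Rightarrow> nat. - (\<alpha> \<circ> u) = (\<lambda>x. \<Sum>\<gamma>\<in>base. of_nat (n \<gamma>) * \<gamma> x)"
      using all unfolding pos_roots_def by blast
    from bchoice[OF this] obtain n :: "('t \<Rightarrow> complex) \<Rightarrow> ('t \<Rightarrow> complex) \<Rightarrow> nat" where
      n: "\<And>\<alpha>. \<alpha> \<in> base \<Longrightarrow> - (\<alpha> \<circ> u) = (\<lambda>x. \<Sum>\<gamma>\<in>base. of_nat (n \<alpha> \<gamma>) * \<gamma> x)" by blast
    have "- (\<beta> \<circ> u) = (\<lambda>x. \<Sum>\<gamma>\<in>base. of_nat (\<Sum>\<alpha>\<in>base. m \<alpha> * n \<alpha> \<gamma>) * \<gamma> x)"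
    proof
      fix x
      have "(- (\<beta> \<circ> u)) x = - (\<Sum>\<alpha>\<in>base. of_nat (m \<alpha>) * \<alpha> (u x))"
        using fun_cong[OF m, of "u x"] by simp
      also have "\<dots> = (\<Sum>\<alpha>\<in>base. of_nat (m \<alpha>) * (- (\<alpha> \<circ> u)) x)"
        by (simp add: sum_negf)
      also have "\<dots> = (\<Sum>\<alpha>\<in>base. of_nat (m \<alpha>) * (\<Sum>\<gamma>\<in>base. of_nat (n \<alpha> \<gamma>) * \<gamma> x))"
        by (intro sum.cong refl) (simp only: n)
      also have "\<dots> = (\<Sum>\<alpha>\<in>base. \<Sum>\<gamma>\<in>base. of_nat (m \<alpha> * n \<alpha> \<gamma>) * \<gamma> x)"
        by (simp add: sum_distrib_left mult.assoc)
      also have "\<dots> = (\<Sum>\<gamma>\<in>base. \<Sum>\<alpha>\<in>base. of_nat (m \<alpha> * n \<alpha> \<gamma>) * \<gamma> x)"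
        by (rule sum.swap)
      also have "\<dots> = (\<Sum>\<gamma>\<in>base. of_nat (\<Sum>\<alpha>\<in>base. m \<alpha> * n \<alpha> \<gamma>) * \<gamma> x)"
        by (simp add: sum_distrib_right)
      finally show "(- (\<beta> \<circ> u)) x = (\<Sum>\<gamma>\<in>base. of_nat (\<Sum>\<alpha>\<in>base. m \<alpha> * n \<alpha> \<gamma>) * \<gamma> x)" .
    qed
    then have "\<exists>m :: ('t \<Rightarrow> complex) \<Rightarrow> nat. - (\<beta> \<circ> u) = (\<lambda>x. \<Sum>\<gamma>\<in>base. of_nat (m \<gamma>) * \<gamma> x)"
      by (rule exI[of _ "\<lambda>\<gamma>. \<Sum>\<alpha>\<in>base. m \<alpha> * n \<alpha> \<gamma>"])
    then show ?thesis
      using root_minus[OF root_comp_weyl[OF u pos_root[OF \<beta>]]] unfolding pos_roots_def by blast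
  qed
  then show ?thesis by (auto simp: inversions_def)
qed

text \<open>A class supported at one point satisfies the congruences as soon as its value vanishes
  on every root hyperplane, which the product of all positive roots does.\<close>

lemma is_schubert_top:
  assumes u: "u \<in> weyl" and all: "inversions u = pos_roots"
  shows "is_schubert u (\<lambda>v\<in>weyl. if v = u then \<Prod>\<beta>\<in>pos_roots. \<beta> else 0)"
proof -
  have van: "(\<Prod>\<beta>\<in>pos_roots. \<beta>) x = 0" if \<gamma>: "\<gamma> \<in> R" "\<gamma> x = 0" for \<gamma> x
  proof -
    obtain \<beta> where \<beta>: "\<beta> \<in> pos_roots" "\<beta> x = 0"
      using pos_or_neg[OF \<gamma>(1)] \<gamma>(2) by (metis fun_Compl_def neg_equal_0_iff_equal)
    then show ?thesis
      using prod.remove[OF finite_pos_roots \<beta>(1), of "\<lambda>\<beta>. \<beta>"] by simp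
  qed
  have "(\<Prod>\<beta>\<in>pos_roots. \<beta>) \<in> Sym_deg (len u)"
    using Sym_deg_prod[OF finite_pos_roots] len_eq_card_inversions[OF u] all pos_root root_linear by simp
  then show ?thesis
    unfolding is_schubert_iff[OF u] gkm_def
    using u all van by (auto simp: Sym_deg_zero bruhat_refl intro: weyl.step)
qed

text \<open>The longest element is never constructed: climbing along left ascents must stop, since
  lengths are bounded by the number of positive roots, and where it stops all positive roots are
  inverted.\<close>

lemma is_schubert_exists: "u \<in> weyl \<Longrightarrow> \<exists>f. is_schubert u f"
proof (induction "card pos_roots - len u" arbitrary: u rule: less_induct)
  case less
  show "\<exists>f. is_schubert u f"
  proof (cases "\<exists>\<alpha>\<in>base. - (\<alpha> \<circ> u) \<notin> pos_roots")
    case True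
    then obtain \<alpha> where \<alpha>: "\<alpha> \<in> base" "\<alpha> \<circ> u \<in> pos_roots"
      using pos_or_neg[OF root_comp_weyl[OF less.prems base_root]] by blast
    have W: "srefl \<alpha> \<circ> u \<in> weyl" using weyl.step[OF base_root[OF \<alpha>(1)] less.prems] .
    have "len (srefl \<alpha> \<circ> u) \<le> card pos_roots"
      unfolding len_eq_card_inversions[OF W]
      by (rule card_mono[OF finite_pos_roots]) (auto simp: inversions_def)
    then have "card pos_roots - len (srefl \<alpha> \<circ> u) < card pos_roots - len u"
      using len_srefl_Suc[OF \<alpha>(1) less.prems \<alpha>(2)] by simp
    from less.hyps[OF this W] obtain f where "is_schubert (srefl \<alpha> \<circ> u) f" by blast
    then show ?thesis by (rule is_schubert_descend[OF \<alpha>(1) less.prems \<alpha>(2)]) blast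
  next
    case False
    then have "inversions u = pos_roots" by (intro inversions_all[OF less.prems]) blast
    from is_schubert_top[OF less.prems this] show ?thesis by blast
  qed
qed

lemma is_schubert_schubert: "u \<in> weyl \<Longrightarrow> is_schubert u (schubert u)"
  unfolding schubert_def
  by (rule theI'[of "is_schubert u"]) (metis is_schubert_exists is_schubert_unique)

lemma schubert_eqI: "u \<in> weyl \<Longrightarrow> is_schubert u f \<Longrightarrow> schubert u = f"
  using is_schubert_schubert is_schubert_unique by blast

section \<open>Behaviour of Schubert classes under left reflections\<close>

lemma schubert_id: "x \<in> weyl \<Longrightarrow> schubert x id = (if x = id then 1 else 0)"
proof -
  assume x: "x \<in> weyl"
  note S = is_schubert_schubert[OF x, unfolded is_schubert_iff[OF x]]
  show ?thesis
  proof (cases "x = id")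
    case True
    have "inversions id = {}" using not_pos_and_neg by (auto simp: inversions_def)
    then show ?thesis using S True by (simp only: prod.empty) simp
  next
    case False
    then have "\<not> bruhat x id" using bruhat_len[of x id] by (auto simp: len_id)
    then have "schubert x id = 0" using S weyl.one by blast
    then show ?thesis using False by simp
  qed
qed

text \<open>The divided difference has degree one less than the length of \<open>a\<close>, while
  its support still has lengths at least that of \<open>a\<close>; so it vanishes.\<close>

lemma schubert_reflect_ascent:
  assumes \<alpha>: "\<alpha> \<in> base" and a: "a \<in> weyl" and pos: "\<alpha> \<circ> a \<in> pos_roots" and v: "v \<in> weyl"
  shows "schubert a (srefl \<alpha> \<circ> v) \<circ> srefl \<alpha> = schubert a v"
proof -
  have r: "\<alpha> \<in> R" using base_root[OF \<alpha>] .
  have W: "srefl \<alpha> \<circ> v \<in> weyl" if "v \<in> weyl" for v using weyl.step[OF r that] .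
  have len: "len (srefl \<alpha> \<circ> a) = Suc (len a)" using len_srefl_Suc[OF \<alpha> a pos] .
  note S = is_schubert_schubert[OF a, unfolded is_schubert_iff[OF a]]
  have g: "gkm (schubert a)" and deg: "\<And>v. v \<in> weyl \<Longrightarrow> schubert a v \<in> Sym_deg (len a)"
    and supp: "\<And>v. v \<in> weyl \<Longrightarrow> schubert a v \<noteq> 0 \<Longrightarrow> bruhat a v"
    using S by blast+
  obtain \<delta> where \<delta>: "\<delta> \<in> extensional weyl" "gkm \<delta>" "\<And>v. v \<in> weyl \<Longrightarrow> \<delta> v \<in> Sym_deg (len a - 1)"
    "\<And>v. v \<in> weyl \<Longrightarrow> len a = 0 \<Longrightarrow> \<delta> v = 0"
    and eq: "\<And>v. v \<in> weyl \<Longrightarrow> schubert a v - (schubert a (srefl \<alpha> \<circ> v) \<circ> srefl \<alpha>) = \<alpha> * \<delta> v"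
    by (rule left_divided_difference[OF \<alpha> g deg]) blast+
  have "\<delta> v = 0"
  proof (rule gkm_eq_zero[OF \<delta>(2,3) _ v])
    fix v assume v: "v \<in> weyl" and nz: "\<delta> v \<noteq> 0"
    have "schubert a v \<noteq> 0 \<or> schubert a (srefl \<alpha> \<circ> v) \<noteq> 0"
    proof (rule ccontr)
      assume "\<not> ?thesis"
      then have "\<alpha> * \<delta> v = \<alpha> * 0" using eq[OF v] by (auto simp: fun_eq_iff)
      from Sym_deg_mult_cancel[OF \<delta>(3)[OF v] Sym_deg_zero root_linear[OF r] root_ne_0[OF r] this]
      show False using nz by simp
    qed
    then consider "bruhat a v" | "bruhat a (srefl \<alpha> \<circ> v)" using supp v W by blast
    then have "len a \<le> len v"
    proof cases
      case 1
      then show ?thesis using bruhat_len by fastforce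
    next
      case 2
      have "len (srefl \<alpha> \<circ> v) \<le> Suc (len v)"
        using pos_or_neg[OF root_comp_weyl[OF v r]] len_srefl_Suc[OF \<alpha> v] len_srefl_pred[OF \<alpha> v] by auto
      \<comment> \<open>Passing from \<open>srefl \<alpha> \<circ> v\<close> to \<open>v\<close> may
        lose one unit of length. That would matter only when \<open>srefl \<alpha> \<circ> v\<close>
        equals \<open>a\<close>, but then \<open>v\<close> is
        \<open>srefl \<alpha> \<circ> a\<close>, which is longer.\<close>
      moreover have "a \<noteq> srefl \<alpha> \<circ> v \<or> len a \<le> len v"
      proof (cases "a = srefl \<alpha> \<circ> v")
        case True
        then have "srefl \<alpha> \<circ> a = v" using srefl_cancel[OF r] by simp
        then show ?thesis using len by auto
      qed simp
      ultimately show ?thesis using bruhat_len[OF 2] by auto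
    qed
    \<comment> \<open>For length 0 the truncated degree would still be 0 and leave no gap; there the
      quotient is zero by construction.\<close>
    moreover have "len a \<noteq> 0" using \<delta>(4)[OF v] nz by blast
    ultimately show "len a - 1 < len v" by simp
  qed
  then show ?thesis using eq[OF v] by simp
qed

lemma schubert_reflect_descent:
  assumes \<alpha>: "\<alpha> \<in> base" and a: "a \<in> weyl" and neg: "- (\<alpha> \<circ> a) \<in> pos_roots" and v: "v \<in> weyl"
  shows "schubert a (srefl \<alpha> \<circ> v) \<circ> srefl \<alpha> = schubert a v - \<alpha> * schubert (srefl \<alpha> \<circ> a) v"
proof -
  have r: "\<alpha> \<in> R" using base_root[OF \<alpha>] .
  define u where "u = srefl \<alpha> \<circ> a"
  have u: "u \<in> weyl" unfolding u_def using weyl.step[OF r a] .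
  have au: "srefl \<alpha> \<circ> u = a" unfolding u_def using srefl_cancel[OF r] .
  have "\<alpha> \<circ> u = - (\<alpha> \<circ> a)"
    unfolding u_def using root_comp_self[OF r] by (simp add: fun_eq_iff)
  then have pos: "\<alpha> \<circ> u \<in> pos_roots" using neg by simp
  obtain \<delta> where "is_schubert u \<delta>"
    and eq: "\<And>v. v \<in> weyl \<Longrightarrow> schubert a v - (schubert a (srefl \<alpha> \<circ> v) \<circ> srefl \<alpha>) = \<alpha> * \<delta> v"
    using is_schubert_descend[OF \<alpha> u pos, unfolded au, OF is_schubert_schubert[OF a]] by blast
  then have "schubert u = \<delta>" using schubert_eqI[OF u] by blast
  then show ?thesis
    using eq[OF v] by (simp add: u_def[symmetric] algebra_simps)
qed

subsection \<open>The left weak order and the expansion formulas\<close>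

lemma len_srefl_less_iff:
  assumes "\<alpha> \<in> base" "x \<in> weyl"
  shows "len (srefl \<alpha> \<circ> x) < len x \<longleftrightarrow> - (\<alpha> \<circ> x) \<in> pos_roots"
  using pos_or_neg[OF root_comp_weyl[OF assms(2) base_root[OF assms(1)]]]
    len_srefl_Suc[OF assms] len_srefl_pred[OF assms] by force

lemma len_srefl_cases:
  assumes "\<alpha> \<in> base" "x \<in> weyl"
  shows "len (srefl \<alpha> \<circ> x) = Suc (len x) \<or> len x = Suc (len (srefl \<alpha> \<circ> x))"
  using pos_or_neg[OF root_comp_weyl[OF assms(2) base_root[OF assms(1)]]]
    len_srefl_Suc[OF assms] len_srefl_pred[OF assms] by blast

lemma schubert_reflect:
  assumes "\<alpha> \<in> base" "x \<in> weyl" "v \<in> weyl"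
  shows "schubert x (srefl \<alpha> \<circ> v) \<circ> srefl \<alpha>
    = schubert x v - (if len (srefl \<alpha> \<circ> x) < len x then \<alpha> * schubert (srefl \<alpha> \<circ> x) v else 0)"
proof (cases "- (\<alpha> \<circ> x) \<in> pos_roots")
  case True
  then show ?thesis
    unfolding len_srefl_less_iff[OF assms(1,2)]
    using schubert_reflect_descent[OF assms(1,2) True assms(3)] by simp
next
  case False
  then have "\<alpha> \<circ> x \<in> pos_roots"
    using pos_or_neg[OF root_comp_weyl[OF assms(2) base_root[OF assms(1)]]] by blast
  then show ?thesis
    unfolding len_srefl_less_iff[OF assms(1,2)]
    using schubert_reflect_ascent[OF assms(1,2) _ assms(3)] False by simp
qed

text \<open>The reflection identity solved for the value at \<open>srefl \<alpha> \<circ> y\<close>,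
  which is how the coefficients change. The class in the correction term is indexed by an element
  that \<alpha> raises, hence is invariant, so its value can be moved back to
  \<open>y\<close>.\<close>

lemma schubert_srefl_arg:
  assumes \<alpha>: "\<alpha> \<in> base" and x: "x \<in> weyl" and y: "y \<in> weyl"
  shows "schubert x (srefl \<alpha> \<circ> y) = (schubert x y \<circ> srefl \<alpha>)
    + (if len (srefl \<alpha> \<circ> x) < len x then \<alpha> * (schubert (srefl \<alpha> \<circ> x) y \<circ> srefl \<alpha>) else 0)"
proof -
  have r: "\<alpha> \<in> R" using base_root[OF \<alpha>] .
  note W = weyl.step[OF r]
  have 1: "schubert x y \<circ> srefl \<alpha> = schubert x (srefl \<alpha> \<circ> y)
      - (if len (srefl \<alpha> \<circ> x) < len x then \<alpha> * schubert (srefl \<alpha> \<circ> x) (srefl \<alpha> \<circ> y) else 0)"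
    using schubert_reflect[OF \<alpha> x W[OF y]] by (simp only: srefl_cancel[OF r])
  have 2: "schubert (srefl \<alpha> \<circ> x) y \<circ> srefl \<alpha> = schubert (srefl \<alpha> \<circ> x) (srefl \<alpha> \<circ> y)"
    if "len (srefl \<alpha> \<circ> x) < len x"
    using schubert_reflect[OF \<alpha> W[OF x] W[OF y]] that by (simp only: srefl_cancel[OF r]) simp
  show ?thesis
    unfolding 1 using 2 by (cases "len (srefl \<alpha> \<circ> x) < len x") simp_all
qed

lemma left_weak_iff:
  assumes "a \<in> weyl" "b \<in> weyl"
  shows "left_weak b a \<longleftrightarrow> len (a \<circ> inv b) + len b = len a"
  unfolding left_weak_def by linarith

lemma inv_comp_inv:
  assumes "a \<in> weyl" "b \<in> weyl"
  shows "inv (a \<circ> inv b) = b \<circ> inv a"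
  using assms o_inv_distrib[OF weyl_bij weyl_bij[OF weyl_inv]] by (simp add: weyl_inv_inv)

lemma left_weak_iff':
  assumes "a \<in> weyl" "b \<in> weyl"
  shows "left_weak b a \<longleftrightarrow> len (b \<circ> inv a) + len b = len a"
  using left_weak_iff[OF assms] len_inv[OF weyl_comp[OF assms(1) weyl_inv[OF assms(2)]]] inv_comp_inv[OF assms]
  by simp

lemma len_le_comp_inv:
  assumes "a \<in> weyl" "b \<in> weyl"
  shows "len a \<le> len (a \<circ> inv b) + len b"
proof -
  have "a \<circ> inv b \<circ> b = a" using assms by (simp add: fun_eq_iff)
  then show ?thesis
    using len_comp_le[OF weyl_comp[OF assms(1) weyl_inv[OF assms(2)]] assms(2)] by simp
qed

text \<open>Identifies the indices whose coefficient acquires a correction term in the first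
  expansion. A simple reflection changes lengths by exactly one, and subadditivity applied to
  \<open>a\<close> and to \<open>srefl \<alpha> \<circ> a\<close> excludes every other
  combination.\<close>

lemma left_weak_srefl_left:
  assumes \<alpha>: "\<alpha> \<in> base" and a: "a \<in> weyl" and b: "b \<in> weyl"
  shows "left_weak b a \<and> len (srefl \<alpha> \<circ> (a \<circ> inv b)) < len (a \<circ> inv b)
    \<longleftrightarrow> len (srefl \<alpha> \<circ> a) < len a \<and> left_weak b (srefl \<alpha> \<circ> a)"
proof -
  have sa: "srefl \<alpha> \<circ> a \<in> weyl" using weyl.step[OF base_root[OF \<alpha>] a] .
  have ab: "a \<circ> inv b \<in> weyl" using weyl_comp[OF a weyl_inv[OF b]] .
  have e: "(srefl \<alpha> \<circ> a) \<circ> inv b = srefl \<alpha> \<circ> (a \<circ> inv b)" by (simp add: o_assoc)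
  show ?thesis
    unfolding left_weak_iff[OF a b] left_weak_iff[OF sa b] e
    using len_srefl_cases[OF \<alpha> a] len_srefl_cases[OF \<alpha> ab] len_le_comp_inv[OF a b]
      len_le_comp_inv[OF sa b, unfolded e] by linarith
qed

text \<open>Supplies the bijection for the second expansion: \<open>b\<close> and
  \<open>srefl \<alpha> \<circ> b\<close> pair a correction of a class with a correction of a
  coefficient. The same length squeeze is used, now with the factor
  \<open>b \<circ> inv a\<close>.\<close>

lemma left_weak_srefl_right:
  assumes \<alpha>: "\<alpha> \<in> base" and a: "a \<in> weyl" and b: "b \<in> weyl"
  shows "left_weak b a \<and> len (srefl \<alpha> \<circ> b) < len b \<longleftrightarrow> left_weak (srefl \<alpha> \<circ> b) a \<and>
    len (srefl \<alpha> \<circ> ((srefl \<alpha> \<circ> b) \<circ> inv a)) < len ((srefl \<alpha> \<circ> b) \<circ> inv a)"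
proof -
  have r: "\<alpha> \<in> R" using base_root[OF \<alpha>] .
  have sb: "srefl \<alpha> \<circ> b \<in> weyl" using weyl.step[OF r b] .
  have ba: "b \<circ> inv a \<in> weyl" using weyl_comp[OF b weyl_inv[OF a]] .
  have e: "(srefl \<alpha> \<circ> b) \<circ> inv a = srefl \<alpha> \<circ> (b \<circ> inv a)" by (simp add: o_assoc)
  have tri: "len a \<le> len (c \<circ> inv a) + len c" if c: "c \<in> weyl" for c
    using len_le_comp_inv[OF a c] len_inv[OF weyl_comp[OF a weyl_inv[OF c]]] inv_comp_inv[OF a c] by simp
  show ?thesis
    unfolding left_weak_iff'[OF a b] left_weak_iff'[OF a sb] e srefl_cancel[OF r]
    using len_srefl_cases[OF \<alpha> b] len_srefl_cases[OF \<alpha> ba] tri[OF b] tri[OF sb, unfolded e] by linarith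
qed

section \<open>Permuted classes and the two expansions\<close>

lemma permuted_apply:
  assumes "w \<in> weyl" "v \<in> weyl"
  shows "permuted f w v = f (w \<circ> v) \<circ> w"
  using assms by (simp add: permuted_def act_def weyl_inv_inv)

lemma permuted_comp_srefl:
  assumes w: "w \<in> weyl" and \<alpha>: "\<alpha> \<in> R" and v: "v \<in> weyl"
  shows "permuted f (w \<circ> srefl \<alpha>) v = permuted f w (srefl \<alpha> \<circ> v) \<circ> srefl \<alpha>"
  using permuted_apply[OF weyl_comp[OF w srefl_weyl[OF \<alpha>]] v] permuted_apply[OF w weyl.step[OF \<alpha> v]]
  by (simp add: o_assoc)

lemma inv_comp_srefl: "w \<in> weyl \<Longrightarrow> \<alpha> \<in> R \<Longrightarrow> inv (w \<circ> srefl \<alpha>) = srefl \<alpha> \<circ> inv w"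
  using o_inv_distrib[OF weyl_bij srefl_bij] inv_srefl by simp

lemma comp_inv_eq_id_iff:
  assumes "a \<in> weyl" "b \<in> weyl"
  shows "a \<circ> inv b = id \<longleftrightarrow> b = a"
proof
  assume "a \<circ> inv b = id"
  then have "a \<circ> inv b \<circ> b = b" by simp
  then show "b = a" using assms by (simp add: fun_eq_iff)
qed (use weyl_inv_comp assms in simp)

lemma sum_comp: "(\<Sum>b\<in>A. f b) \<circ> u = (\<Sum>b\<in>A. f b \<circ> u)" for f :: "'b \<Rightarrow> 't \<Rightarrow> complex"
  by (induction A rule: infinite_finite_induct) (auto simp: fun_eq_iff)

text \<open>Letters are appended on the right, so that the inverse acquires them on the left, where
  the reflection identity for the coefficients applies.\<close>

lemma weyl_rev_induct [consumes 1, case_names id step]: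
  assumes "w \<in> weyl" and id: "P id"
    and step: "\<And>w \<alpha>. w \<in> weyl \<Longrightarrow> \<alpha> \<in> base \<Longrightarrow> P w \<Longrightarrow> P (w \<circ> srefl \<alpha>)"
  shows "P w"
proof -
  have "P (word as)" if "set as \<subseteq> base" for as
    using that
  proof (induction as rule: rev_induct)
    case Nil
    show "P (word [])" using id by (simp only: word.simps)
  next
    case (snoc \<alpha> as)
    have "word (as @ [\<alpha>]) = word as \<circ> srefl \<alpha>" by (simp add: word_append)
    moreover have "P (word as \<circ> srefl \<alpha>)"
      using snoc by (intro step word_weyl) simp_all
    ultimately show "P (word (as @ [\<alpha>]))" by (simp only:)
  qed
  then show ?thesis using weyl_word[OF assms(1)] by blast
qed

definition down_set :: "('t \<Rightarrow> 't) \<Rightarrow> ('t \<Rightarrow> 't) set"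
  where "down_set a = {b. b \<in> weyl \<and> left_weak b a}"

lemma finite_down_set: "finite (down_set a)"
  using finite_weyl by (simp add: down_set_def)

lemma self_down_set: "a \<in> weyl \<Longrightarrow> a \<in> down_set a"
  using weyl_inv_comp by (simp add: down_set_def left_weak_def len_id)

text \<open>The induction must leave \<open>a\<close> free: its hypothesis is used for
  \<open>a\<close> and for \<open>srefl \<alpha> \<circ> a\<close>. The coefficient corrections
  assemble into \<alpha> times the expansion for the latter, which is just what the reflected class
  of \<open>a\<close> lacks.\<close>

lemma schubert_expand_permuted:
  assumes "w \<in> weyl" "a \<in> weyl" "v \<in> weyl"
  shows "schubert a v = (\<Sum>b\<in>down_set a. schubert (a \<circ> inv b) (inv w) * permuted (schubert b) w v)"
  using assms
proof (induction arbitrary: a v rule: weyl_rev_induct)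
  case (id a v)
  have "(\<Sum>b\<in>down_set a. schubert (a \<circ> inv b) (inv id) * permuted (schubert b) id v)
      = (\<Sum>b\<in>down_set a. if b = a then schubert a v else 0)"
  proof (rule sum.cong)
    fix b assume "b \<in> down_set a"
    then have b: "b \<in> weyl" by (simp add: down_set_def)
    show "schubert (a \<circ> inv b) (inv id) * permuted (schubert b) id v = (if b = a then schubert a v else 0)"
      using schubert_id[OF weyl_comp[OF id(1) weyl_inv[OF b]]] comp_inv_eq_id_iff[OF id(1) b]
        permuted_apply[OF weyl.one id(2)] by (simp add: inv_id)
  qed simp
  then show "schubert a v = (\<Sum>b\<in>down_set a. schubert (a \<circ> inv b) (inv id) * permuted (schubert b) id v)"
    using self_down_set[OF id(1)] finite_down_set by simp
next
  case (step w \<alpha> a v)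
  have r: "\<alpha> \<in> R" using base_root[OF step.hyps(2)] .
  let ?s = "srefl \<alpha>"
  have sa: "?s \<circ> a \<in> weyl" and sv: "?s \<circ> v \<in> weyl"
    using weyl.step[OF r] step.prems by blast+
  define P where "P b = permuted (schubert b) (w \<circ> ?s) v" for b
  define X where "X b = \<alpha> * (schubert (?s \<circ> (a \<circ> inv b)) (inv w) \<circ> ?s) * P b" for b
  have IH: "schubert c (?s \<circ> v) \<circ> ?s = (\<Sum>b\<in>down_set c. (schubert (c \<circ> inv b) (inv w) \<circ> ?s) * P b)"
    if c: "c \<in> weyl" for c
  proof -
    have "schubert c (?s \<circ> v) \<circ> ?s
        = (\<Sum>b\<in>down_set c. schubert (c \<circ> inv b) (inv w) * permuted (schubert b) w (?s \<circ> v)) \<circ> ?s"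
      using step.IH[OF c sv] by (rule arg_cong)
    also have "\<dots> = (\<Sum>b\<in>down_set c. (schubert (c \<circ> inv b) (inv w) \<circ> ?s) * P b)"
      unfolding sum_comp P_def permuted_comp_srefl[OF step.hyps(1) r step.prems(2)]
      by (intro sum.cong refl) (simp add: fun_eq_iff)
    finally show ?thesis .
  qed
  have X: "(\<Sum>b\<in>down_set a. if len (?s \<circ> (a \<circ> inv b)) < len (a \<circ> inv b) then X b else 0)
      = (if len (?s \<circ> a) < len a then \<Sum>b\<in>down_set (?s \<circ> a). X b else 0)"
  proof -
    have "{b \<in> down_set a. len (?s \<circ> (a \<circ> inv b)) < len (a \<circ> inv b)}
        = (if len (?s \<circ> a) < len a then down_set (?s \<circ> a) else {})"
      using left_weak_srefl_left[OF step.hyps(2) step.prems(1)] by (auto simp: down_set_def)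
    then show ?thesis
      by (simp add: sum.inter_filter[OF finite_down_set, symmetric] del: o_apply)
  qed
  have "(\<Sum>b\<in>down_set a. schubert (a \<circ> inv b) (inv (w \<circ> ?s)) * P b)
      = (\<Sum>b\<in>down_set a. (schubert (a \<circ> inv b) (inv w) \<circ> ?s) * P b
        + (if len (?s \<circ> (a \<circ> inv b)) < len (a \<circ> inv b) then X b else 0))"
  proof (rule sum.cong)
    fix b assume "b \<in> down_set a"
    then have "a \<circ> inv b \<in> weyl"
      using step.prems(1) weyl_comp weyl_inv by (simp add: down_set_def)
    from schubert_srefl_arg[OF step.hyps(2) this weyl_inv[OF step.hyps(1)]]
    show "schubert (a \<circ> inv b) (inv (w \<circ> ?s)) * P b = (schubert (a \<circ> inv b) (inv w) \<circ> ?s) * P b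
        + (if len (?s \<circ> (a \<circ> inv b)) < len (a \<circ> inv b) then X b else 0)"
      unfolding inv_comp_srefl[OF step.hyps(1) r] X_def by (simp add: distrib_right del: o_apply)
  qed simp
  also have "\<dots> = (schubert a (?s \<circ> v) \<circ> ?s) + (if len (?s \<circ> a) < len a then \<Sum>b\<in>down_set (?s \<circ> a). X b else 0)"
    unfolding sum.distrib X IH[OF step.prems(1)] ..
  also have "(\<Sum>b\<in>down_set (?s \<circ> a). X b) = \<alpha> * (schubert (?s \<circ> a) (?s \<circ> v) \<circ> ?s)"
    unfolding IH[OF sa] sum_distrib_left X_def by (simp only: o_assoc mult.assoc)
  also have "(schubert a (?s \<circ> v) \<circ> ?s)
      + (if len (?s \<circ> a) < len a then \<alpha> * (schubert (?s \<circ> a) (?s \<circ> v) \<circ> ?s) else 0) = schubert a v"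
  proof -
    \<comment> \<open>When \<alpha> lowers \<open>a\<close>, it raises \<open>?s \<circ> a\<close>,
      so the class of \<open>?s \<circ> a\<close> is unchanged by the reflection.\<close>
    have "schubert (?s \<circ> a) (?s \<circ> v) \<circ> ?s = schubert (?s \<circ> a) v" if "len (?s \<circ> a) < len a"
      using schubert_reflect[OF step.hyps(2) sa step.prems(2)] that by (simp only: srefl_cancel[OF r]) simp
    then show ?thesis
      unfolding schubert_reflect[OF step.hyps(2) step.prems]
      by (cases "len (?s \<circ> a) < len a") simp_all
  qed
  finally show "schubert a v = (\<Sum>b\<in>down_set a. schubert (a \<circ> inv b) (inv (w \<circ> ?s)) * permuted (schubert b) (w \<circ> ?s) v)"
    unfolding P_def ..
qed

text \<open>Here \<open>a\<close> stays fixed. Reflecting each class subtracts terms over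
  \<open>?A\<close>, whereas the new coefficients require added terms over \<open>?B\<close>; the
  pairing of these two sets changes the sign.\<close>

lemma permuted_schubert_expand:
  assumes "w \<in> weyl" "a \<in> weyl" "v \<in> weyl"
  shows "permuted (schubert a) w v
    = (\<Sum>b\<in>down_set a. (- 1) ^ len (b \<circ> inv a) * schubert (b \<circ> inv a) (inv w) * schubert b v)"
  using assms
proof (induction arbitrary: v rule: weyl_rev_induct)
  case (id v)
  have "(\<Sum>b\<in>down_set a. (- 1) ^ len (b \<circ> inv a) * schubert (b \<circ> inv a) (inv id) * schubert b v)
      = (\<Sum>b\<in>down_set a. if b = a then schubert a v else 0)"
  proof (rule sum.cong)
    fix b assume "b \<in> down_set a"
    then have b: "b \<in> weyl" by (simp add: down_set_def)
    show "(- 1) ^ len (b \<circ> inv a) * schubert (b \<circ> inv a) (inv id) * schubert b v = (if b = a then schubert a v else 0)"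
      using schubert_id[OF weyl_comp[OF b weyl_inv[OF id(1)]]] comp_inv_eq_id_iff[OF b id(1)]
      by (auto simp: inv_id len_id)
  qed simp
  then show "permuted (schubert a) id v
    = (\<Sum>b\<in>down_set a. (- 1) ^ len (b \<circ> inv a) * schubert (b \<circ> inv a) (inv id) * schubert b v)"
    using self_down_set[OF id(1)] finite_down_set permuted_apply[OF weyl.one id(2)] by simp
next
  case (step w \<alpha> v)
  have r: "\<alpha> \<in> R" using base_root[OF step.hyps(2)] .
  let ?s = "srefl \<alpha>"
  have sv: "?s \<circ> v \<in> weyl" using weyl.step[OF r] step.prems by blast
  define c :: "('t \<Rightarrow> 't) \<Rightarrow> 't \<Rightarrow> complex" where "c b = (- 1) ^ len (b \<circ> inv a)" for b
  define T where "T b = schubert (b \<circ> inv a) (inv w) \<circ> ?s" for b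
  let ?A = "{b \<in> down_set a. len (?s \<circ> b) < len b}"
  let ?B = "{b \<in> down_set a. len (?s \<circ> (b \<circ> inv a)) < len (b \<circ> inv a)}"
  have c_comp: "c b \<circ> ?s = c b" for b
  proof -
    have "((- 1) ^ n :: 't \<Rightarrow> complex) \<circ> ?s = (- 1) ^ n" for n
      by (induction n) (auto simp: fun_eq_iff)
    then show ?thesis by (simp add: c_def)
  qed
  have key: "(\<Sum>b\<in>?A. c b * T b * (\<alpha> * schubert (?s \<circ> b) v)) = - (\<Sum>b\<in>?B. c b * (\<alpha> * T (?s \<circ> b)) * schubert b v)"
  proof -
    have "(\<Sum>b\<in>?A. c b * T b * (\<alpha> * schubert (?s \<circ> b) v)) = (\<Sum>b\<in>?B. - (c b * (\<alpha> * T (?s \<circ> b)) * schubert b v))"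
    proof (rule sum.reindex_bij_witness[of _ "\<lambda>b. ?s \<circ> b" "\<lambda>b. ?s \<circ> b"])
      fix b assume b: "b \<in> ?A"
      then have bW: "b \<in> weyl" by (simp add: down_set_def)
      note sb = weyl.step[OF r bW]
      show "?s \<circ> (?s \<circ> b) = b" by (rule srefl_cancel[OF r])
      show sbB: "?s \<circ> b \<in> ?B"
        using b left_weak_srefl_right[OF step.hyps(2) step.prems(1) bW] sb by (simp add: down_set_def)
      \<comment> \<open>The paired indices have factors \<open>b \<circ> inv a\<close> of lengths
        differing by one, so their signs \<open>c\<close> are opposite.\<close>
      have "len ((?s \<circ> b) \<circ> inv a) = Suc (len (b \<circ> inv a))"
        using sbB len_srefl_cases[OF step.hyps(2) weyl_comp[OF bW weyl_inv[OF step.prems(1)]]]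
          srefl_cancel[OF r, of "b \<circ> inv a"] by (auto simp: comp_assoc)
      then have "c (?s \<circ> b) = - c b" by (simp add: c_def)
      then show "- (c (?s \<circ> b) * (\<alpha> * T (?s \<circ> (?s \<circ> b))) * schubert (?s \<circ> b) v) = c b * T b * (\<alpha> * schubert (?s \<circ> b) v)"
        unfolding srefl_cancel[OF r] by (simp add: mult_ac)
    next
      fix b assume b: "b \<in> ?B"
      then have bW: "b \<in> weyl" by (simp add: down_set_def)
      note sb = weyl.step[OF r bW]
      show "?s \<circ> (?s \<circ> b) = b" by (rule srefl_cancel[OF r])
      show "?s \<circ> b \<in> ?A"
        using b left_weak_srefl_right[OF step.hyps(2) step.prems(1) sb] sb
        unfolding srefl_cancel[OF r] by (simp add: down_set_def srefl_cancel[OF r])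
    qed
    then show ?thesis by (simp only: sum_negf)
  qed
  have "permuted (schubert a) (w \<circ> ?s) v
      = (\<Sum>b\<in>down_set a. c b * schubert (b \<circ> inv a) (inv w) * schubert b (?s \<circ> v)) \<circ> ?s"
    unfolding permuted_comp_srefl[OF step.hyps(1) r step.prems(2)] c_def
    using step.IH[OF step.prems(1) sv] by (rule arg_cong)
  also have "\<dots> = (\<Sum>b\<in>down_set a. c b * T b * (schubert b (?s \<circ> v) \<circ> ?s))"
    unfolding sum_comp T_def
  proof (intro sum.cong refl)
    fix b
    show "c b * schubert (b \<circ> inv a) (inv w) * schubert b (?s \<circ> v) \<circ> ?s
        = c b * (schubert (b \<circ> inv a) (inv w) \<circ> ?s) * (schubert b (?s \<circ> v) \<circ> ?s)"
      using fun_cong[OF c_comp[of b]] by (simp add: fun_eq_iff)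
  qed
  also have "\<dots> = (\<Sum>b\<in>down_set a. c b * T b * schubert b v
      - (if len (?s \<circ> b) < len b then c b * T b * (\<alpha> * schubert (?s \<circ> b) v) else 0))"
  proof (rule sum.cong)
    fix b assume "b \<in> down_set a"
    then have b: "b \<in> weyl" by (simp add: down_set_def)
    show "c b * T b * (schubert b (?s \<circ> v) \<circ> ?s) = c b * T b * schubert b v
      - (if len (?s \<circ> b) < len b then c b * T b * (\<alpha> * schubert (?s \<circ> b) v) else 0)"
      unfolding schubert_reflect[OF step.hyps(2) b step.prems(2)]
      by (simp add: right_diff_distrib del: o_apply)
  qed simp
  also have "\<dots> = (\<Sum>b\<in>down_set a. c b * T b * schubert b v) - (\<Sum>b\<in>?A. c b * T b * (\<alpha> * schubert (?s \<circ> b) v))"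
    by (simp only: sum_subtractf sum.inter_filter[OF finite_down_set])
  also have "\<dots> = (\<Sum>b\<in>down_set a. c b * T b * schubert b v) + (\<Sum>b\<in>?B. c b * (\<alpha> * T (?s \<circ> b)) * schubert b v)"
    unfolding key by simp
  also have "\<dots> = (\<Sum>b\<in>down_set a. c b * T b * schubert b v
      + (if len (?s \<circ> (b \<circ> inv a)) < len (b \<circ> inv a) then c b * (\<alpha> * T (?s \<circ> b)) * schubert b v else 0))"
    by (simp only: sum.distrib sum.inter_filter[OF finite_down_set])
  also have "\<dots> = (\<Sum>b\<in>down_set a. c b * schubert (b \<circ> inv a) (inv (w \<circ> ?s)) * schubert b v)"
  proof (rule sum.cong)
    fix b assume "b \<in> down_set a"
    then have "b \<circ> inv a \<in> weyl"
      using step.prems(1) weyl_comp weyl_inv by (simp add: down_set_def)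
    from schubert_srefl_arg[OF step.hyps(2) this weyl_inv[OF step.hyps(1)]]
    show "c b * T b * schubert b v
      + (if len (?s \<circ> (b \<circ> inv a)) < len (b \<circ> inv a) then c b * (\<alpha> * T (?s \<circ> b)) * schubert b v else 0)
      = c b * schubert (b \<circ> inv a) (inv (w \<circ> ?s)) * schubert b v"
      unfolding inv_comp_srefl[OF step.hyps(1) r] T_def comp_assoc by (simp add: algebra_simps del: o_apply)
  qed simp
  finally show "permuted (schubert a) (w \<circ> ?s) v
    = (\<Sum>b\<in>down_set a. (- 1) ^ len (b \<circ> inv a) * schubert (b \<circ> inv a) (inv (w \<circ> ?s)) * schubert b v)"
    unfolding c_def .
qed

end

theorem mainTheorem11:
  fixes scale :: "complex \<Rightarrow> 't::ab_group_add \<Rightarrow> 't"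
    and R base :: "('t \<Rightarrow> complex) set"
    and coroot :: "('t \<Rightarrow> complex) \<Rightarrow> 't"
    and a w :: "'t \<Rightarrow> 't"
  defines "W \<equiv> semisimple_root_system.weyl scale R coroot"
    and "len \<equiv> semisimple_root_system.len scale coroot base"
    and "le_L \<equiv> semisimple_root_system.left_weak scale coroot base"
    and "perm \<equiv> semisimple_root_system.permuted scale R coroot"
    and "\<tau> \<equiv> semisimple_root_system.schubert scale R coroot base"
  assumes "semisimple_root_system scale R coroot base"
    and "a \<in> W" and "w \<in> W"
  shows "(\<forall>v\<in>W. \<tau> a v = (\<Sum>b | b \<in> W \<and> le_L b a. \<tau> (a \<circ> inv b) (inv w) * perm (\<tau> b) w v)) \<and>
         (\<forall>v\<in>W. perm (\<tau> a) w v =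
            (\<Sum>b | b \<in> W \<and> le_L b a. (-1) ^ len (b \<circ> inv a) * \<tau> (b \<circ> inv a) (inv w) * \<tau> b v))"
proof -
  interpret semisimple_root_system scale R coroot base by fact
  show ?thesis
    unfolding assms(1-5)
    using schubert_expand_permuted[of w a] permuted_schubert_expand[of w a]
      assms(7,8)[unfolded assms(1)]
    by (simp only: down_set_def) simp
qed

end
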